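(* Let $C_0$ and $C_1$ be compact connected topological $n$-manifolds with connected boundary, where $n\geq 2$. If $\operatorname{int}(C_0)$ and $\operatorname{int}(C_1)$ are homeomorphic, then $\partial C_0$ and $\partial C_1$ are topologically $h$-cobordant.
   Context: Two closed topological $(n-1)$-manifolds $Y_0,Y_1$ are topologically $h$-cobordant if there is a compact topological $n$-manifold $W$ with $\partial W\cong Y_0\sqcup Y_1$ such that both inclusions $Y_0\hookrightarrow W$ and $Y_1\hookrightarrow W$ are homotopy equivalences (no condition on Whitehead torsion is imposed). *)

theory Defs
  imports "HOL-Analysis.Analysis"
begin

definition half_space :: "nat \<Rightarrow> (nat \<Rightarrow> real) topology"
  where "half_space n = subtopology (Euclidean_space n) {x. 0 \<le> x 0}"

text \<open>
  Topological \<open>n\<close>-manifolds, possibly with boundary. Charts identify open sets of \<open>X\<close> with open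
  sets of the half-space.
  In dimension 0 the half-space is the one-point space, so no special case is needed. The empty
  space counts as a manifold of every dimension.
\<close>

definition top_manifold :: "nat \<Rightarrow> 'a topology \<Rightarrow> bool"
  where "top_manifold n X \<longleftrightarrow>
    Hausdorff_space X \<and> second_countable X \<and>
    (\<forall>x \<in> topspace X. \<exists>U V. openin X U \<and> x \<in> U \<and> openin (half_space n) V \<and>
       subtopology X U homeomorphic_space subtopology (half_space n) V)"

definition manifold_interior :: "nat \<Rightarrow> 'a topology \<Rightarrow> 'a set"
  where "manifold_interior n X =
    {x \<in> topspace X. \<exists>U V. openin X U \<and> x \<in> U \<and> openin (Euclidean_space n) V \<and>
       subtopology X U homeomorphic_space subtopology (Euclidean_space n) V}"

definition manifold_boundary :: "nat \<Rightarrow> 'a topology \<Rightarrow> 'a set"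
  where "manifold_boundary n X = topspace X - manifold_interior n X"

definition closed_top_manifold :: "nat \<Rightarrow> 'a topology \<Rightarrow> bool"
  where "closed_top_manifold n X \<longleftrightarrow>
    top_manifold n X \<and> compact_space X \<and> manifold_boundary n X = {}"

text \<open>
  Binary disjoint union of spaces over possibly different types; the library's
  \<open>sum_topology\<close> requires all summands to have the same type.
\<close>

definition disjoint_sum_topology :: "'a topology \<Rightarrow> 'b topology \<Rightarrow> ('a + 'b) topology"
  where "disjoint_sum_topology X Y =
    topology (\<lambda>U. openin X (Inl -` U) \<and> openin Y (Inr -` U))"

lemma openin_disjoint_sum_topology:
  "openin (disjoint_sum_topology X Y) U \<longleftrightarrow> openin X (Inl -` U) \<and> openin Y (Inr -` U)"
proof -
  have "istopology (\<lambda>U. openin X (Inl -` U) \<and> openin Y (Inr -` U))"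
    unfolding istopology_def vimage_Int vimage_Union by blast
  then show ?thesis
    by (simp add: disjoint_sum_topology_def)
qed

lemma topspace_disjoint_sum_topology:
  "topspace (disjoint_sum_topology X Y) = topspace X <+> topspace Y"
proof
  show "topspace (disjoint_sum_topology X Y) \<subseteq> topspace X <+> topspace Y"
  proof
    fix z assume "z \<in> topspace (disjoint_sum_topology X Y)"
    then obtain U where U: "openin (disjoint_sum_topology X Y) U" "z \<in> U"
      by blast
    then have "Inl -` U \<subseteq> topspace X" "Inr -` U \<subseteq> topspace Y"
      by (auto simp: openin_disjoint_sum_topology dest: openin_subset)
    with U(2) show "z \<in> topspace X <+> topspace Y"
      by (cases z) auto
  qed
  have "Inl -` (topspace X <+> topspace Y) = topspace X"
    "Inr -` (topspace X <+> topspace Y) = topspace Y"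
    by auto
  then have "openin (disjoint_sum_topology X Y) (topspace X <+> topspace Y)"
    by (simp add: openin_disjoint_sum_topology)
  then show "topspace X <+> topspace Y \<subseteq> topspace (disjoint_sum_topology X Y)"
    by (rule openin_subset)
qed

definition homotopy_equivalence_map :: "'a topology \<Rightarrow> 'b topology \<Rightarrow> ('a \<Rightarrow> 'b) \<Rightarrow> bool"
  where "homotopy_equivalence_map X Y f \<longleftrightarrow>
    continuous_map X Y f \<and>
    (\<exists>g. continuous_map Y X g \<and>
         homotopic_with (\<lambda>_. True) X X (g \<circ> f) id \<and>
         homotopic_with (\<lambda>_. True) Y Y (f \<circ> g) id)"

text \<open>
  \<open>m\<close> is the dimension of the ends, so the cobordism \<open>W\<close> has dimension \<open>m + 1\<close>.
  The identification of the boundary of \<open>W\<close> with the disjoint union is the homeomorphism \<open>h\<close>, and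
  \<open>h \<circ> Inl\<close>, \<open>h \<circ> Inr\<close> are the two inclusions of the ends.
  HOL cannot quantify over carrier types inside a formula. Fixing the points of \<open>W\<close> to be of type
  \<open>nat \<Rightarrow> real\<close> is no restriction: a second countable Hausdorff space has at most continuum many
  points, hence is homeomorphic to a space carried by that type.
\<close>

definition top_h_cobordant :: "nat \<Rightarrow> 'a topology \<Rightarrow> 'b topology \<Rightarrow> bool"
  where "top_h_cobordant m Y0 Y1 \<longleftrightarrow>
    closed_top_manifold m Y0 \<and> closed_top_manifold m Y1 \<and>
    (\<exists>(W :: (nat \<Rightarrow> real) topology) h.
       top_manifold (m + 1) W \<and> compact_space W \<and>
       homeomorphic_map (disjoint_sum_topology Y0 Y1)
         (subtopology W (manifold_boundary (m + 1) W)) h \<and>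
       homotopy_equivalence_map Y0 W (h \<circ> Inl) \<and>
       homotopy_equivalence_map Y1 W (h \<circ> Inr))"

end

theory Submission
  imports Defs "HOL-Homology.Invariance_of_Domain"
begin

text \<open>
  Choose collars \<open>c0\<close>, \<open>c1\<close> of \<open>\<partial>C0\<close>, \<open>\<partial>C1\<close> (Connelly's proof of Brown's collar theorem) and a
  homeomorphism \<open>\<phi>\<close> of the interiors, and let \<open>W\<close> be \<open>C1\<close> minus the \<open>\<phi>\<close>-image of the part of \<open>C0\<close>
  beyond the collar level \<open>1/2\<close>. Then \<open>W - \<partial>C1\<close> is the half-open collar \<open>\<phi> (c0 (\<partial>C0 \<times> (0, 1/2]))\<close>,
  which gives the manifold structure and the second boundary component \<open>\<phi> (c0 (\<partial>C0 \<times> {1/2}))\<close>.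
  By compactness the far end of this half-open collar lies in \<open>c1 (\<partial>C1 \<times> [0, e))\<close>. So \<open>W\<close> can be
  slid along the first collar into the second one and then projected to \<open>\<partial>C1\<close>; sliding along \<open>c1\<close>
  off \<open>\<partial>C1\<close> and projecting along the first collar retracts \<open>W\<close> onto the other end.
\<close>

section \<open>Sliding along product charts\<close>

text \<open>The collar coming from \<open>C0\<close> and the collar of \<open>\<partial>C1\<close>
  are two product structures near the same end of the common interior, but their levels need not
  match, so \<open>W\<close> is not claimed to be a product. What remains is that both products are
  open in \<open>W\<close> and together cover it. Pushing along the factor of one of them brings all
  of \<open>W\<close> into the other, where the level can be contracted; the situation is symmetric,
  so one lemma gives both homotopy equivalences. Each push has to be the identity off a compact part
  of its product, as this makes its extension by the identity continuous. The level
  \<open>1/2\<close> merely lies strictly inside a collar of height \<open>1\<close>. Cutting there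
  yields a manifold because the reflection \<open>t -> 1/2 - t\<close> makes \<open>W\<close> near
  the new end look like \<open>C0\<close> near its boundary, so no new charts have to be built.
  Telling the boundary of \<open>W\<close> from its interior then rests on invariance of
  domain.\<close>

lemma continuous_map_compose2:
  "continuous_map X Y f \<Longrightarrow> continuous_map Y Z g \<Longrightarrow> continuous_map X Z (\<lambda>x. g (f x))"
  using continuous_map_compose[of X Y f Z g] by (simp add: o_def)

text \<open>\<open>k\<close> maps the compact \<open>T\<close> to a closed set because
  \<open>X\<close> is Hausdorff. So \<open>D\<close> and the complement of that image are open and
  cover \<open>X\<close>, and on their overlap \<open>g (a, z) = z\<close> makes the two formulas
  agree. The factor \<open>A\<close> carries the parameter of a homotopy.\<close>

lemma continuous_map_extend_by_snd:
  assumes X: "Hausdorff_space X" and D: "openin X D"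
    and k: "homeomorphic_maps Z (subtopology X D) k k'"
    and T: "compactin Z T"
    and g: "continuous_map (prod_topology A Z) Z g"
    and gT: "\<And>a z. a \<in> topspace A \<Longrightarrow> z \<in> topspace Z - T \<Longrightarrow> g (a, z) = z"
  shows "continuous_map (prod_topology A X) X
           (\<lambda>(a, w). if w \<in> D then k (g (a, k' w)) else w)"
proof -
  have ck: "continuous_map Z X k"
    using k unfolding homeomorphic_maps_def
    by (meson continuous_map_into_fulltopology)
  have ck': "continuous_map (subtopology X D) Z k'"
    using k unfolding homeomorphic_maps_def by blast
  have DX: "D \<subseteq> topspace X" using D openin_subset by blast
  have kk: "k (k' w) = w" if "w \<in> D" for w
    using k that DX unfolding homeomorphic_maps_def by auto
  have k'Z: "k' w \<in> topspace Z" if "w \<in> D" for w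
    using ck' that DX by (auto simp: continuous_map_def Pi_iff)
  have cl: "closedin X (k ` T)"
    using X T ck by (meson compactin_imp_closedin image_compactin)
  define U where "U = (\<lambda>i::bool. if i then topspace A \<times> D else topspace A \<times> (topspace X - k ` T))"
  define F where "F = (\<lambda>i::bool. if i then (\<lambda>p. k (g (fst p, k' (snd p)))) else snd)"
  show ?thesis
  proof (rule pasting_lemma[where I = UNIV and T = U and f = F])
    fix i :: bool
    show "openin (prod_topology A X) (U i)"
      using D cl by (auto simp: U_def openin_prod_Times_iff openin_diff)
    show "continuous_map (subtopology (prod_topology A X) (U i)) X (F i)"
    proof (cases i)
      case True
      have eq: "subtopology (prod_topology A X) (U i) = prod_topology A (subtopology X D)"
        using True by (simp add: U_def subtopology_Times)
      have "continuous_map (prod_topology A (subtopology X D)) (prod_topology A Z) (\<lambda>p. (fst p, k' (snd p)))"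
        by (intro continuous_map_pairedI continuous_map_fst continuous_map_compose2[OF continuous_map_snd ck'])
      then show ?thesis
        unfolding eq using True
        by (simp add: F_def) (rule continuous_map_compose2[OF continuous_map_compose2[OF _ g] ck])
    next
      case False
      then show ?thesis
        by (simp add: F_def continuous_map_from_subtopology continuous_map_snd)
    qed
  next
    fix i j p assume p: "p \<in> topspace (prod_topology A X) \<inter> U i \<inter> U j"
    obtain a w where [simp]: "p = (a, w)" by force
    have *: "k (g (a, k' w)) = w" if "w \<in> D" "w \<notin> k ` T" "a \<in> topspace A"
      using gT[of a "k' w"] that kk k'Z by (metis DiffI image_eqI)
    show "F i p = F j p"
      using p * by (cases i; cases j) (auto simp: F_def U_def)
  next
    fix p assume p: "p \<in> topspace (prod_topology A X)"
    obtain a w where [simp]: "p = (a, w)" by force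
    show "\<exists>j. j \<in> UNIV \<and> p \<in> U j \<and>
        (case p of (a, w) \<Rightarrow> if w \<in> D then k (g (a, k' w)) else w) = F j p"
    proof (cases "w \<in> D")
      case True then show ?thesis using p by (intro exI[of _ True]) (auto simp: U_def F_def)
    next
      case False
      have "k ` T \<subseteq> D"
        using k T compactin_subset_topspace[OF T] unfolding homeomorphic_maps_def continuous_map_def Pi_iff
        by auto
      then show ?thesis using p False by (intro exI[of _ False]) (auto simp: U_def F_def)
    qed
  qed
qed

text \<open>
  The slide \<open>g\<close> along the factor \<open>J\<close> is the identity off a compact set, so it extends to all of \<open>X\<close>;
  its image lies in the product \<open>E\<close>, where projecting to the level \<open>a\<close> gives the homotopy inverse.
\<close>

lemma homotopy_equivalence_map_slide:
  fixes J J' :: "real set" and Y :: "'b topology"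
  assumes X: "Hausdorff_space X"
    and D: "openin X D" and k: "homeomorphic_maps (prod_topology Y (top_of_set J)) (subtopology X D) k k'"
    and J: "convex J"
    and T: "compactin Y (topspace Y)" "compact T" "T \<subseteq> J"
    and g: "continuous_on J g" "g ` J \<subseteq> J" "\<And>t. t \<in> J - T \<Longrightarrow> g t = t"
    and m: "homeomorphic_maps (prod_topology Y' (top_of_set J')) (subtopology X E) m m'"
    and J': "convex J'" "a \<in> J'"
    and gE: "\<And>w. w \<in> topspace X - D \<Longrightarrow> w \<in> E"
            "\<And>y t. y \<in> topspace Y \<Longrightarrow> t \<in> J \<Longrightarrow> k (y, g t) \<in> E"
    and fixed: "\<And>y. y \<in> topspace Y' \<Longrightarrow> m (y, a) \<in> D \<Longrightarrow> g (snd (k' (m (y, a)))) = snd (k' (m (y, a)))"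
  shows "homotopy_equivalence_map Y' X (\<lambda>y. m (y, a))"
proof -
  let ?Z = "prod_topology Y (top_of_set J)"
  let ?Z' = "prod_topology Y' (top_of_set J')"
  let ?I = "top_of_set {0..1::real}"
  have DX: "D \<subseteq> topspace X" using D openin_subset by blast
  have ck': "continuous_map (subtopology X D) ?Z k'"
    using k unfolding homeomorphic_maps_def by blast
  have k'Z: "k' w \<in> topspace Y \<times> J" if "w \<in> D" for w
    using ck' that DX by (auto simp: continuous_map_def Pi_iff)
  have kk: "k (k' w) = w" if "w \<in> D" for w
    using k that DX unfolding homeomorphic_maps_def by auto
  define G where "G = (\<lambda>w. if w \<in> D then k (fst (k' w), g (snd (k' w))) else w)"
  \<comment> \<open>The straight line from the identity to the slide. Convexity of \<open>J\<close>
    keeps it in the product, and it is stationary off \<open>T\<close>, so it extends by the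
    identity at every time.\<close>
  define H where "H = (\<lambda>(s::real, z). (fst z :: 'b, (1 - s) * snd z + s * g (snd z)))"
  have Hc: "continuous_map (prod_topology ?I ?Z) ?Z H"
  proof -
    have cg: "continuous_map (prod_topology ?I ?Z) (top_of_set J) (\<lambda>p. g (snd (snd p)))"
      by (rule continuous_map_compose2[OF continuous_map_compose2[OF continuous_map_snd continuous_map_snd]])
         (use g in \<open>auto\<close>)
    have c1: "continuous_map (prod_topology ?I ?Z) euclideanreal (\<lambda>p. snd (snd p))"
      using continuous_map_compose2[OF continuous_map_snd[of ?I ?Z] continuous_map_snd]
      by (simp add: continuous_map_in_subtopology)
    have c0: "continuous_map (prod_topology ?I ?Z) euclideanreal fst"
      using continuous_map_fst[of ?I ?Z] by (simp add: continuous_map_in_subtopology)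
    have "continuous_map (prod_topology ?I ?Z) euclideanreal (\<lambda>p. (1 - fst p) * snd (snd p) + fst p * g (snd (snd p)))"
      using cg by (intro continuous_intros c0 c1) (simp add: continuous_map_in_subtopology)
    moreover have "(1 - s) * t + s * g t \<in> J" if "s \<in> {0..1}" "t \<in> J" for s t
      using J g(2) that by (auto simp: convex_alt)
    ultimately have "continuous_map (prod_topology ?I ?Z) (top_of_set J) (\<lambda>p. (1 - fst p) * snd (snd p) + fst p * g (snd (snd p)))"
      by (auto simp: continuous_map_in_subtopology)
    then show ?thesis
      unfolding H_def case_prod_unfold
      by (intro continuous_map_pairedI continuous_map_compose2[OF continuous_map_snd continuous_map_fst])
  qed
  have "continuous_map (prod_topology ?I X) X (\<lambda>(s, w). if w \<in> D then k (H (s, k' w)) else w)"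
  proof (rule continuous_map_extend_by_snd[OF X D k _ Hc])
    show "compactin ?Z (topspace Y \<times> T)"
      using T by (simp add: compactin_Times compactin_subtopology)
    show "\<And>s z. s \<in> topspace ?I \<Longrightarrow> z \<in> topspace ?Z - topspace Y \<times> T \<Longrightarrow> H (s, z) = z"
      using g(3) by (auto simp: H_def algebra_simps; blast)
  qed
  moreover have "(if w \<in> D then k (H (0, k' w)) else w) = w" for w
    by (simp add: H_def kk)
  moreover have "(if w \<in> D then k (H (1, k' w)) else w) = G w" for w
    by (simp add: H_def G_def)
  ultimately have idG: "homotopic_with (\<lambda>_. True) X X id G"
    unfolding homotopic_with_def by (intro exI conjI) auto
  have GE: "G w \<in> E" if "w \<in> topspace X" for w
    using that gE k'Z unfolding G_def by (auto simp: mem_Times_iff)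
  have cG: "continuous_map X (subtopology X E) G"
    using homotopic_with_imp_continuous_maps[OF idG] GE by (auto simp: continuous_map_in_subtopology)
  have cm: "continuous_map ?Z' (subtopology X E) m" and cm': "continuous_map (subtopology X E) ?Z' m'"
    and mm: "\<And>z. z \<in> topspace ?Z' \<Longrightarrow> m' (m z) = z" "\<And>w. w \<in> topspace (subtopology X E) \<Longrightarrow> m (m' w) = w"
    using m unfolding homeomorphic_maps_def by blast+
  have m'Z: "fst (m' w) \<in> topspace Y'" "snd (m' w) \<in> J'" if "w \<in> E" "w \<in> topspace X" for w
    using cm' that by (auto simp: continuous_map_def Pi_iff mem_Times_iff)
  define r where "r = (\<lambda>w. fst (m' (G w)))"
  have cr: "continuous_map X Y' r"
    unfolding r_def by (rule continuous_map_compose2[OF continuous_map_compose2[OF cG cm'] continuous_map_fst])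
  have ci: "continuous_map Y' X (\<lambda>y. m (y, a))"
  proof (rule continuous_map_compose2[where f = "\<lambda>y. (y, a)" and g = m])
    show "continuous_map Y' ?Z' (\<lambda>y. (y, a))"
      using J' by (auto intro!: continuous_map_pairedI)
    show "continuous_map ?Z' X m" using cm continuous_map_into_fulltopology by blast
  qed
  have mX: "m (y, a) \<in> topspace X \<inter> E" if "y \<in> topspace Y'" for y
    using cm that J' by (auto simp: continuous_map_def Pi_iff)
  \<comment> \<open>By \<open>fixed\<close> the slide does not move the end, so \<open>r\<close>
    after the inclusion is the identity itself.\<close>
  have Gm: "G (m (y, a)) = m (y, a)" if "y \<in> topspace Y'" for y
    using fixed[OF that] kk[of "m (y,a)"] by (auto simp: G_def)
  have "homotopic_with (\<lambda>_. True) Y' Y' (r \<circ> (\<lambda>y. m (y, a))) id"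
    by (rule homotopic_with_id2) (use J'(2) in \<open>auto simp: r_def Gm mm\<close>)
  moreover have "homotopic_with (\<lambda>_. True) X X ((\<lambda>y. m (y, a)) \<circ> r) id"
  proof -
    \<comment> \<open>Moving the level linearly between \<open>a\<close> and its value at
      \<open>G w\<close> connects the inclusion after \<open>r\<close> with \<open>G\<close>, which
      is already homotopic to the identity.\<close>
    define K where "K = (\<lambda>(s::real, w). m (fst (m' (G w)), (1 - s) * a + s * snd (m' (G w))))"
    have "continuous_map (prod_topology ?I X) X K"
      unfolding K_def case_prod_unfold
    proof (rule continuous_map_compose2[where g = m])
      show "continuous_map ?Z' X m" using cm continuous_map_into_fulltopology by blast
      have c2: "continuous_map (prod_topology ?I X) ?Z' (\<lambda>p. m' (G (snd p)))"
        by (rule continuous_map_compose2[OF continuous_map_compose2[OF continuous_map_snd cG] cm'])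
      have c0: "continuous_map (prod_topology ?I X) euclideanreal fst"
        using continuous_map_fst[of ?I X] by (simp add: continuous_map_in_subtopology)
      have c1: "continuous_map (prod_topology ?I X) euclideanreal (\<lambda>p. snd (m' (G (snd p))))"
        using continuous_map_compose2[OF c2 continuous_map_snd] by (simp add: continuous_map_in_subtopology)
      have "continuous_map (prod_topology ?I X) euclideanreal (\<lambda>p. (1 - fst p) * a + fst p * snd (m' (G (snd p))))"
        by (intro continuous_intros c0 c1) auto
      moreover have "(1 - s) * a + s * snd (m' (G w)) \<in> J'" if "s \<in> {0..1}" "w \<in> topspace X" for s w
      proof -
        have "G w \<in> topspace X" using cG that by (auto simp: continuous_map_def Pi_iff)
        then have "snd (m' (G w)) \<in> J'" using m'Z GE that by blast
        then show ?thesis using J' that by (auto simp: convex_alt)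
      qed
      ultimately have "continuous_map (prod_topology ?I X) (top_of_set J') (\<lambda>p. (1 - fst p) * a + fst p * snd (m' (G (snd p))))"
        by (auto simp: continuous_map_in_subtopology)
      then show "continuous_map (prod_topology ?I X) ?Z' (\<lambda>p. (fst (m' (G (snd p))), (1 - fst p) * a + fst p * snd (m' (G (snd p)))))"
        by (intro continuous_map_pairedI continuous_map_compose2[OF c2 continuous_map_fst])
    qed
    moreover have "K (1, w) = G w" if "w \<in> topspace X" for w
      using mm(2)[of "G w"] GE[OF that] continuous_map_image_subset_topspace[OF cG] that by (auto simp: K_def)
    ultimately have "homotopic_with (\<lambda>_. True) X X ((\<lambda>y. m (y, a)) \<circ> r) G"
      by (subst homotopic_with) (auto simp: K_def r_def intro!: exI[of _ K])
    then show ?thesis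
      using idG homotopic_with_sym homotopic_with_trans by blast
  qed
  ultimately show ?thesis
    unfolding homotopy_equivalence_map_def using cr ci by blast
qed

section \<open>The collar theorem\<close>

lemma continuous_map_extend_by_id:
  assumes X: "Hausdorff_space X" and D: "openin X D"
    and k: "homeomorphic_maps Z (subtopology X D) k k'"
    and T: "compactin Z T"
    and g: "continuous_map Z Z g"
    and gT: "\<And>z. z \<in> topspace Z - T \<Longrightarrow> g z = z"
  shows "continuous_map X X (\<lambda>w. if w \<in> D then k (g (k' w)) else w)"
proof -
  \<comment> \<open>A one-point parameter space.\<close>
  have c1: "continuous_map (prod_topology (top_of_set {0::real}) X) X
           (\<lambda>(a, w). if w \<in> D then k ((\<lambda>p. g (snd p)) (a, k' w)) else w)"
    by (rule continuous_map_extend_by_snd[OF X D k T])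
       (auto intro: continuous_map_compose2[OF continuous_map_snd g] gT)
  have c2: "continuous_map X (prod_topology (top_of_set {0::real}) X) (\<lambda>w. (0, w))"
    by (auto intro!: continuous_map_pairedI)
  show ?thesis
    using continuous_map_compose2[OF c2 c1] by (simp cong: if_cong)
qed

text \<open>\<open>B\<close> need not lie in \<open>D\<close>, so the same notion covers local
  collars and, when \<open>B\<close> does lie in \<open>D\<close>, global ones. The interval of
  heights is half-open so that the collar can be an open set of \<open>M\<close>.\<close>

definition is_collar :: "'a topology \<Rightarrow> 'a set \<Rightarrow> 'a set \<Rightarrow> real \<Rightarrow> ('a \<times> real \<Rightarrow> 'a) \<Rightarrow> ('a \<Rightarrow> 'a \<times> real) \<Rightarrow> bool"
  where "is_collar M B D e k k' \<longleftrightarrow> openin M D \<and> 0 < e \<and>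
    homeomorphic_maps (prod_topology (subtopology M (D \<inter> B)) (top_of_set {0..<e})) (subtopology M D) k k' \<and>
    (\<forall>x \<in> D \<inter> B. k (x, 0) = x)"

text \<open>
  \<open>M\<close> with an outer collar \<open>B \<times> [0, 1]\<close> attached, realised inside \<open>M \<times> [0, 1]\<close> to avoid a quotient.
  Local collars continue into the outer collar; stretching along them one at a time moves the
  boundary outwards from level \<open>0\<close> to level \<open>1\<close> (Connelly).
\<close>

definition external_collar :: "'a topology \<Rightarrow> 'a set \<Rightarrow> ('a \<times> real) topology"
  where "external_collar M B = subtopology (prod_topology M (top_of_set {0..1})) {p. snd p = 0 \<or> fst p \<in> B}"

text \<open>Inside the external collar, \<open>a = 0\<close> cuts out a copy of \<open>M\<close>,
  and \<open>a >= 0\<close> with \<open>a = 1\<close> on \<open>B\<close> gives everything. The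
  collar theorem passes from the first to the second.\<close>

definition below :: "('a \<Rightarrow> real) \<Rightarrow> ('a \<times> real) set"
  where "below a = {p. snd p \<le> a (fst p)}"

text \<open>
  For \<open>u \<le> a\<close> this fixes \<open>u \<le> -d\<close> and maps \<open>[-d, a]\<close> linearly onto \<open>[-d, b]\<close>. Cutting off at \<open>1\<close> makes
  it a self-map of \<open>(-e, 1]\<close> also for \<open>u > a\<close>.
\<close>

definition stretch :: "real \<Rightarrow> real \<Rightarrow> real \<Rightarrow> real \<Rightarrow> real"
  where "stretch d a b u = min 1 (u + max 0 (u + d) * ((b - a) / (a + d)))"

text \<open>The form with \<open>max\<close> gives continuity in \<open>a\<close>, \<open>b\<close>
  and \<open>u\<close> at once; the affine form, of slope \<open>(b + d) / (a + d)\<close>, is the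
  one to compute with.\<close>

lemma stretch_alt:
  fixes a b d u :: real
  assumes "d > 0" "0 \<le> a" "-d \<le> u"
  shows "u + max 0 (u + d) * ((b - a) / (a + d)) = (u + d) * ((b + d) / (a + d)) - d"
proof -
  have "0 \<le> u + d" "a + d > 0" using assms by linarith+
  then show ?thesis by (simp add: field_simps)
qed

lemma stretch_below: "u \<le> -d \<Longrightarrow> d > 0 \<Longrightarrow> stretch d a b u = u"
  by (simp add: stretch_def)

lemma stretch_above:
  assumes "d > 0" "0 \<le> a" "-d \<le> u" "u \<le> a" "0 \<le> b" "b \<le> 1"
  shows "stretch d a b u = (u + d) * ((b + d) / (a + d)) - d"
    and "-d \<le> stretch d a b u" "stretch d a b u \<le> b"
proof -
  have "(u + d) / (a + d) \<le> 1" using assms by (simp add: field_simps)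
  then have "(u + d) / (a + d) * (b + d) \<le> 1 * (b + d)"
    by (rule mult_right_mono) (use assms in auto)
  then have *: "(u + d) * ((b + d) / (a + d)) - d \<le> b" by simp
  then show "stretch d a b u = (u + d) * ((b + d) / (a + d)) - d"
    using assms unfolding stretch_def stretch_alt[OF assms(1-3)] by simp
  then show "stretch d a b u \<le> b" "-d \<le> stretch d a b u"
    using * assms by auto
qed

lemma stretch_le: "d > 0 \<Longrightarrow> 0 \<le> a \<Longrightarrow> u \<le> a \<Longrightarrow> 0 \<le> b \<Longrightarrow> b \<le> 1 \<Longrightarrow> stretch d a b u \<le> b"
  using stretch_above(3)[of d a u b] stretch_below[of u d a b] by linarith

text \<open>The affine pieces for \<open>(a, b)\<close> and \<open>(b, a)\<close> have reciprocal
  slopes, and the cut-off at \<open>1\<close> does not act because the values are at most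
  \<open>b\<close> and \<open>a\<close>.\<close>

lemma stretch_stretch:
  assumes "d > 0" "0 \<le> a" "a \<le> 1" "u \<le> a" "0 \<le> b" "b \<le> 1"
  shows "stretch d b a (stretch d a b u) = u"
proof (cases "-d \<le> u")
  case True
  have "stretch d b a (stretch d a b u) = (stretch d a b u + d) * ((a + d) / (b + d)) - d"
    using assms True stretch_above[of d a u b] by (intro stretch_above(1)) auto
  also have "\<dots> = u"
    using stretch_above(1)[of d a u b] assms True by (simp add: field_simps)
  finally show ?thesis .
qed (use assms in \<open>simp add: stretch_below\<close>)

lemma stretch_top: "d > 0 \<Longrightarrow> 0 \<le> a \<Longrightarrow> 0 \<le> b \<Longrightarrow> b \<le> 1 \<Longrightarrow> stretch d a b a = b"
  using stretch_above(1)[of d a a b] by simp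

text \<open>
  The coordinate \<open>u\<close> is minus the inner collar height inside \<open>M\<close> and the outer height outside.
\<close>

lemma external_collar_chart:
  assumes c: "is_collar M B D e k k'" and B: "B \<subseteq> topspace M"
  shows "homeomorphic_maps (prod_topology (subtopology M (D \<inter> B)) (top_of_set {-e<..1}))
           (subtopology (external_collar M B) (D \<times> UNIV))
           (\<lambda>(x, u). (k (x, max (-u) 0), max u 0))
           (\<lambda>(y, t). (fst (k' y), t - snd (k' y)))"
    (is "homeomorphic_maps ?Z ?P ?K ?K'")
proof -
  let ?Y = "subtopology M (D \<inter> B)"
  have D: "openin M D" and e: "e > 0"
    and k: "continuous_map (prod_topology ?Y (top_of_set {0..<e})) (subtopology M D) k"
    and k': "continuous_map (subtopology M D) (prod_topology ?Y (top_of_set {0..<e})) k'"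
    and kk: "\<And>x t. x \<in> D \<inter> B \<Longrightarrow> 0 \<le> t \<Longrightarrow> t < e \<Longrightarrow> k' (k (x, t)) = (x, t)"
    and kk': "\<And>y. y \<in> D \<Longrightarrow> k (k' y) = y"
    and k0: "\<And>x. x \<in> D \<inter> B \<Longrightarrow> k (x, 0) = x"
    using c B openin_subset[of M D] unfolding is_collar_def homeomorphic_maps_def by (auto simp: subset_iff)
  have DM: "D \<subseteq> topspace M" using D openin_subset by blast
  have kD: "k (x, t) \<in> D" if "x \<in> D \<inter> B" "0 \<le> t" "t < e" for x t
    using k that B by (auto simp: continuous_map_def Pi_iff)
  have k'Z: "fst (k' y) \<in> D \<inter> B" "0 \<le> snd (k' y)" "snd (k' y) < e" if "y \<in> D" for y
    using k' that DM by (auto simp: continuous_map_def Pi_iff mem_Times_iff)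
  \<comment> \<open>A point of \<open>B\<close> has inner height \<open>0\<close>. So at most one of
    the inner and the outer height is nonzero, and the difference \<open>t - snd (k' y)\<close>
    loses no information.\<close>
  have k'B: "k' y = (y, 0)" if "y \<in> D" "y \<in> B" for y
    using kk[of y 0] k0[of y] that e by auto
  have "continuous_map ?Z ?P ?K"
  proof -
    have c1: "continuous_map ?Z euclideanreal snd"
      using continuous_map_snd[of ?Y "top_of_set {-e<..1}"] by (simp add: continuous_map_in_subtopology)
    have c2: "continuous_map ?Z (prod_topology ?Y (top_of_set {0..<e})) (\<lambda>p. (fst p, max (- snd p) 0))"
      using e by (intro continuous_map_pairedI continuous_map_fst continuous_map_into_subtopology continuous_intros c1) auto
    have c3: "continuous_map ?Z M (\<lambda>p. k (fst p, max (- snd p) 0))"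
      using continuous_map_compose2[OF c2 k] by (simp add: continuous_map_in_subtopology)
    have c4: "continuous_map ?Z (top_of_set {0..1}) (\<lambda>p. max (snd p) 0)"
      by (intro continuous_map_into_subtopology continuous_intros c1) auto
    have "k (fst p, max (- snd p) 0) \<in> D \<and> (max (snd p) 0 = 0 \<or> k (fst p, max (- snd p) 0) \<in> B)" if "p \<in> topspace ?Z" for p
      using that kD[of "fst p" "max (- snd p) 0"] k0[of "fst p"] e by (cases "snd p \<le> 0") (auto simp: max_def)
    then show ?thesis
      unfolding external_collar_def case_prod_unfold
      by (intro continuous_map_into_subtopology continuous_map_pairedI c3 c4) auto
  qed
  moreover have "continuous_map ?P ?Z ?K'"
  proof -
    have c0: "continuous_map ?P (subtopology M D) fst"
      unfolding external_collar_def
      by (rule continuous_map_into_subtopology) (auto intro!: continuous_map_from_subtopology continuous_map_fst)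
    have "continuous_map ?P (top_of_set {0..1::real}) snd"
      by (auto simp: external_collar_def intro!: continuous_map_from_subtopology continuous_map_snd)
    then have c1: "continuous_map ?P euclideanreal snd"
      by (simp add: continuous_map_in_subtopology)
    have c2: "continuous_map ?P (prod_topology ?Y (top_of_set {0..<e})) (\<lambda>p. k' (fst p))"
      by (rule continuous_map_compose2[OF c0 k'])
    have c3: "continuous_map ?P euclideanreal (\<lambda>p. snd (k' (fst p)))"
      using continuous_map_compose2[OF c2 continuous_map_snd] by (simp add: continuous_map_in_subtopology)
    have r: "-e < t - snd (k' y) \<and> t - snd (k' y) \<le> 1" if "(y, t) \<in> topspace ?P" for y t
      using that k'Z[of y] k'B[of y] by (auto simp: external_collar_def)
    show ?thesis
      unfolding case_prod_unfold
      by (intro continuous_map_pairedI continuous_map_compose2[OF c2 continuous_map_fst]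
           continuous_map_into_subtopology continuous_intros c1 c3) (use r in auto)
  qed
  moreover have "?K' (?K z) = z" if "z \<in> topspace ?Z" for z
  proof -
    obtain x u where z: "z = (x, u)" by force
    show ?thesis
      using that k0[of x] kk[of x "-u"] kk[of x 0] e by (cases "u \<ge> 0") (auto simp: z)
  qed
  moreover have "?K (?K' p) = p" if "p \<in> topspace ?P" for p
  proof -
    obtain y t where p: "p = (y, t)" by force
    show ?thesis
      using that k'B[of y] kk'[of y] k'Z[of y] k0[of y] by (cases "t = 0") (auto simp: p external_collar_def)
  qed
  ultimately show ?thesis unfolding homeomorphic_maps_def by blast
qed

text \<open>In the chart over \<open>D\<close> the map stretches level \<open>a x\<close> to level
  \<open>b x\<close>. As \<open>a\<close> and \<open>b\<close> agree on \<open>B - C\<close>, it is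
  the identity off a compact set and extends by the identity; exchanging \<open>a\<close> and
  \<open>b\<close> gives the inverse.\<close>

lemma external_collar_stretch:
  assumes M: "Hausdorff_space M" and B: "B \<subseteq> topspace M"
    and c: "is_collar M B D e k k'"
    and a: "continuous_map M euclideanreal a" "\<And>x. 0 \<le> a x" "\<And>x. a x \<le> 1"
    and b: "continuous_map M euclideanreal b" "\<And>x. 0 \<le> b x" "\<And>x. b x \<le> 1"
    and C: "compactin M C" "C \<subseteq> D \<inter> B" "\<And>x. x \<in> B - C \<Longrightarrow> a x = b x"
  shows "\<exists>f f'. homeomorphic_maps (subtopology (external_collar M B) (below a))
           (subtopology (external_collar M B) (below b)) f f' \<and> (\<forall>x \<in> B. f (x, a x) = (x, b x))"
proof -
  let ?P = "external_collar M B"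
  let ?Y = "subtopology M (D \<inter> B)"
  let ?Z = "prod_topology ?Y (top_of_set {-e<..1})"
  define K where "K = (\<lambda>(x, u). (k (x, max (-u) 0), max u 0))"
  define K' where "K' = (\<lambda>(y, t). (fst (k' y), t - snd (k' y)))"
  define Q where "Q = D \<times> (UNIV :: real set) \<inter> topspace ?P"
  \<comment> \<open>Levels in \<open>(-e, -d]\<close> stay fixed, so the support
    \<open>C x [-d, 1]\<close> is compact although \<open>(-e, 1]\<close> is open below.\<close>
  define d where "d = e / 2"
  have D: "openin M D" and e: "e > 0" and d: "d > 0" "d < e"
    using c unfolding is_collar_def d_def by auto
  have hK: "homeomorphic_maps ?Z (subtopology ?P Q) K K'"
    using external_collar_chart[OF c B] unfolding K_def K'_def Q_def
    by (metis Int_commute subtopology_restrict)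
  have oQ: "openin ?P Q"
  proof -
    have "Q = (D \<times> {0..1}) \<inter> {p. snd p = 0 \<or> fst p \<in> B}"
      using openin_subset[OF D] by (auto simp: Q_def external_collar_def)
    moreover have "openin (prod_topology M (top_of_set {0..1})) (D \<times> {0..1::real})"
      using D by (simp add: openin_prod_Times_iff)
    ultimately show ?thesis
      unfolding external_collar_def openin_subtopology by blast
  qed
  have HP: "Hausdorff_space ?P"
    using M by (simp add: external_collar_def Hausdorff_space_subtopology Hausdorff_space_prod_topology Hausdorff_space_euclidean)
  have k0: "k (y, 0) = y" if "y \<in> D" "y \<in> B" for y
    using c that unfolding is_collar_def by auto
  have k'B: "k' y = (y, 0)" if "y \<in> D" "y \<in> B" for y
  proof -
    have "(y, 0) \<in> topspace (prod_topology ?Y (top_of_set {0..<e}))"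
      using that e B by auto
    then have "k' (k (y, 0)) = (y, 0)"
      using c unfolding is_collar_def homeomorphic_maps_def by blast
    then show ?thesis using k0 that by simp
  qed
  have QP: "topspace (subtopology ?P Q) = Q"
    using openin_subset[OF oQ] by auto
  have cK: "continuous_map ?Z (subtopology ?P Q) K" and cK': "continuous_map (subtopology ?P Q) ?Z K'"
    and KK: "\<And>z. z \<in> topspace ?Z \<Longrightarrow> K' (K z) = z" and KK': "\<And>p. p \<in> Q \<Longrightarrow> K (K' p) = p"
    using hK unfolding homeomorphic_maps_def QP by blast+
  have KQ: "K z \<in> Q" if "z \<in> topspace ?Z" for z
    using continuous_map_image_subset_topspace[OF cK] that unfolding QP by blast
  have "K' p \<in> topspace ?Z" if "p \<in> Q" for p
    using continuous_map_image_subset_topspace[OF cK'] that unfolding QP by blast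
  then have K': "fst (K' p) \<in> D \<inter> B" "-e < snd (K' p)" "snd (K' p) \<le> 1" if "p \<in> Q" for p
    using that by (auto simp: mem_Times_iff)
  define S where "S = (\<lambda>a b w. if w \<in> Q then K ((\<lambda>z. (fst z, stretch d (a (fst z)) (b (fst z)) (snd z))) (K' w)) else w)"
  have cS: "continuous_map ?P ?P (S a b)"
    if a: "continuous_map M euclideanreal a" "\<And>x. 0 \<le> a x" "\<And>x. a x \<le> 1"
    and b: "continuous_map M euclideanreal b" "\<And>x. 0 \<le> b x" "\<And>x. b x \<le> 1"
    and ab: "\<And>x. x \<in> B - C \<Longrightarrow> a x = b x" for a b
    unfolding S_def
  proof (rule continuous_map_extend_by_id[OF HP oQ hK])
    show "compactin ?Z (C \<times> {-d..1})"
      using C(1,2) d by (auto simp: compactin_Times compactin_subtopology)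
    have c0: "continuous_map ?Z M fst"
      using continuous_map_fst[of ?Y "top_of_set {-e<..1}"] by (simp add: continuous_map_in_subtopology)
    have c1: "continuous_map ?Z euclideanreal snd"
      using continuous_map_snd[of ?Y "top_of_set {-e<..1}"] by (simp add: continuous_map_in_subtopology)
    have ne: "a x + d \<noteq> 0" for x using a(2)[of x] d by linarith
    have "continuous_map ?Z euclideanreal (\<lambda>z. stretch d (a (fst z)) (b (fst z)) (snd z))"
      unfolding stretch_def
      by (intro continuous_intros c1 continuous_map_compose2[OF c0 a(1)] continuous_map_compose2[OF c0 b(1)] ne)
    moreover have "-e < stretch d (a x) (b x) u" if "-e < u" "u \<le> 1" for x u
    proof (cases "-d \<le> u")
      case True
      then have "(u + d) * ((b x + d) / (a x + d)) \<ge> 0"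
        using d a(2)[of x] b(2)[of x] by simp
      then show ?thesis
        unfolding stretch_def stretch_alt[OF d(1) a(2) True] using d by auto
    qed (use that d in \<open>simp add: stretch_below\<close>)
    moreover have "stretch d (a x) (b x) u \<le> 1" for x u by (simp add: stretch_def)
    ultimately show "continuous_map ?Z ?Z (\<lambda>z. (fst z, stretch d (a (fst z)) (b (fst z)) (snd z)))"
      by (intro continuous_map_pairedI continuous_map_fst continuous_map_into_subtopology) auto
    fix z assume "z \<in> topspace ?Z - C \<times> {-d..1}"
    then consider "fst z \<in> B - C" "snd z \<le> 1" | "snd z < -d"
      by (cases z) auto
    then show "(fst z, stretch d (a (fst z)) (b (fst z)) (snd z)) = z"
    proof cases
      case 1
      then show ?thesis by (simp add: stretch_def ab prod_eq_iff)
    next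
      case 2
      then show ?thesis using d by (simp add: stretch_below prod_eq_iff)
    qed
  qed
  \<comment> \<open>For \<open>u <= 0\<close> both sides hold because \<open>f >= 0\<close>; only
    outer levels are constrained.\<close>
  have below_iff: "K (x, u) \<in> below f \<longleftrightarrow> u \<le> f x"
    if f: "\<And>x. 0 \<le> f x" and x: "x \<in> D \<inter> B" and u: "-e < u" for x u and f :: "'a \<Rightarrow> real"
  proof (cases "u > 0")
    case True
    then show ?thesis using x k0 by (simp add: K_def below_def)
  next
    case False
    then have "u \<le> f x" using f[of x] by linarith
    then show ?thesis using False f by (simp add: K_def below_def max_def)
  qed
  have S: "S a b p \<in> below b \<and> S b a (S a b p) = p"
    if p: "p \<in> topspace ?P" "p \<in> below a" 
    and a: "\<And>x. 0 \<le> a x" "\<And>x. a x \<le> 1"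
    and b: "\<And>x. 0 \<le> b x" "\<And>x. b x \<le> 1"
    and ab: "\<And>x. x \<in> B - C \<Longrightarrow> a x = b x" for a b p
  proof (cases "p \<in> Q")
    case True
    obtain x u where xu: "K' p = (x, u)" by force
    have x: "x \<in> D \<inter> B" "-e < u" "u \<le> 1" using K'[OF True] xu by auto
    have ua: "u \<le> a x" using below_iff[OF a(1) x(1,2)] KK'[OF True] p(2) xu by simp
    let ?v = "stretch d (a x) (b x) u"
    have v: "?v \<le> b x" using stretch_le d a b ua by simp
    have v1: "?v \<le> 1" using v b(2)[of x] by linarith
    have ve: "-e < ?v"
    proof (cases "-d \<le> u")
      case True
      then have "-d \<le> ?v"
        using stretch_above(2) d a b ua by blast
      then show ?thesis using d by linarith
    qed (use x d in \<open>simp add: stretch_below\<close>)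
    have z: "(x, ?v) \<in> topspace ?Z" using x B v1 ve by auto
    have Sp: "S a b p = K (x, ?v)" using True xu by (simp add: S_def)
    then have "S b a (S a b p) = K (x, stretch d (b x) (a x) ?v)"
      using KQ[OF z] KK[OF z] by (simp add: S_def)
    also have "\<dots> = p"
      using stretch_stretch[OF d(1) a ua b] KK'[OF True] xu by simp
    finally show ?thesis using Sp below_iff[OF b(1) x(1) ve] v by simp
  next
    case False
    obtain y t where yt: "p = (y, t)" by force
    \<comment> \<open>Off the chart a point lies at level \<open>0\<close> or over
      \<open>B - C\<close>, where \<open>a = b\<close>.\<close>
    have "t \<le> b y"
    proof (cases "t = 0")
      case False
      then have "y \<in> B" using p yt by (auto simp: external_collar_def)
      moreover have "y \<notin> C" using \<open>p \<notin> Q\<close> p C(2) yt by (auto simp: Q_def)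
      ultimately show ?thesis using ab p(2) yt by (auto simp: below_def)
    qed (use b in simp)
    then show ?thesis using False yt by (simp add: S_def below_def)
  qed
  have C3: "\<And>x. x \<in> B - C \<Longrightarrow> b x = a x" using C(3) by simp
  have "homeomorphic_maps (subtopology ?P (below a)) (subtopology ?P (below b)) (S a b) (S b a)"
    unfolding homeomorphic_maps_def
    using cS[OF a b C(3)] cS[OF b a C3] S[OF _ _ a(2,3) b(2,3) C(3)] S[OF _ _ b(2,3) a(2,3) C3]
    by (auto simp: continuous_map_in_subtopology continuous_map_from_subtopology)
  moreover have "S a b (x, a x) = (x, b x)" if x: "x \<in> B" for x
  proof (cases "x \<in> D")
    case True
    have "(x, a x) \<in> Q" using True x a B by (auto simp: Q_def external_collar_def)
    moreover have "K' (x, a x) = (x, a x)" using k'B True x by (simp add: K'_def)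
    ultimately have "S a b (x, a x) = K (x, b x)"
      using stretch_top d a b by (simp add: S_def)
    then show ?thesis using b(2)[of x] k0 True x by (simp add: K_def max_def)
  next
    case False
    then show ?thesis using C x by (auto simp: S_def Q_def)
  qed
  ultimately show ?thesis by blast
qed

text \<open>A capped sum of finitely many bump functions, each supported on \<open>B\<close> within
  one local collar, grows on \<open>B\<close> from \<open>0\<close> to \<open>1\<close> one summand
  at a time. Each summand costs one stretch. The composite identifies \<open>M\<close> with the
  whole external collar, and the outer part \<open>B x (0, 1]\<close> pulls back to the collar
  sought.\<close>

theorem collar_exists:
  assumes M: "compact_space M" "Hausdorff_space M" and B: "closedin M B"
    and loc: "\<And>x. x \<in> B \<Longrightarrow> \<exists>D e k k'. x \<in> D \<and> is_collar M B D e k k'"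
  shows "\<exists>D k k'. B \<subseteq> D \<and> is_collar M B D 1 k k'"
proof -
  let ?P = "external_collar M B"
  have BM: "B \<subseteq> topspace M" using B closedin_subset by blast
  have bump: "\<exists>f C D e k k'. continuous_map M euclideanreal f \<and> (\<forall>y. 0 \<le> f y) \<and> f x = 2 \<and>
      is_collar M B D e k k' \<and> compactin M C \<and> C \<subseteq> D \<inter> B \<and> (\<forall>y \<in> B - C. f y = 0)"
    if x: "x \<in> B" for x
  proof -
    obtain D e k k' where D: "x \<in> D" and c: "is_collar M B D e k k'"
      using loc[OF x] by blast
    have oD: "openin M D" using c is_collar_def by metis
    have "regular_space M" 
      using M by (metis compact_Hausdorff_imp_regular_space)
    then obtain U V where UV: "openin M U" "closedin M V" "x \<in> U" "U \<subseteq> V" "V \<subseteq> D"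
      using oD D by (metis neighbourhood_base_of neighbourhood_base_of_closedin)
    have "completely_regular_space M"
      using M by (metis compact_Hausdorff_or_regular_imp_normal_space normal_imp_completely_regular_space)
    moreover have "closedin M (topspace M - U)" "x \<in> topspace M - (topspace M - U)"
      using UV(1,3) x BM by auto
    ultimately obtain f where f: "continuous_map M (top_of_set {0..1::real}) f" "f x = 0" "f ` (topspace M - U) \<subseteq> {1}"
      unfolding completely_regular_space_def by meson
    \<comment> \<open>Off \<open>topspace M\<close> the values of \<open>f\<close> are arbitrary;
      \<open>min 1\<close> keeps \<open>h\<close> nonnegative even there, as the bounds of a stretch
      must be. The factor \<open>2\<close> makes \<open>h\<close> exceed \<open>1\<close> on a
      neighbourhood of \<open>x\<close>.\<close>
    define h where "h = (\<lambda>y. 2 * (1 - min 1 (f y)))"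
    have cf: "continuous_map M euclideanreal f" using f(1) by (simp add: continuous_map_in_subtopology)
    have "continuous_map M euclideanreal h"
      unfolding h_def by (intro continuous_intros cf)
    moreover have "compactin M (V \<inter> B)"
      using UV(2) B M(1) by (simp add: closedin_compact_space closedin_Int)
    moreover have "h y = 0" if "y \<in> B - V \<inter> B" for y
    proof -
      have "y \<in> topspace M - U" using that UV(4) BM by blast
      then have "f y = 1" using f(3) by blast
      then show ?thesis by (simp add: h_def)
    qed
    moreover have "h x = 2" "\<And>y. 0 \<le> h y" using f(2) by (auto simp: h_def)
    ultimately show ?thesis using c UV(5) by blast
  qed
  \<comment> \<open>Only \<open>f\<close> and \<open>C\<close> need to be functions of
    \<open>x\<close>; the local collar stays under its quantifier until its stretch is
    performed.\<close>
  then have "\<forall>x \<in> B. \<exists>f C. continuous_map M euclideanreal f \<and> (\<forall>y. 0 \<le> f y) \<and> f x = 2 \<and>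
      (\<exists>D e k k'. is_collar M B D e k k' \<and> C \<subseteq> D \<inter> B) \<and> compactin M C \<and> (\<forall>y \<in> B - C. f y = 0)"
    by meson
  from bchoice[OF this] obtain f where "\<forall>x \<in> B. \<exists>C. continuous_map M euclideanreal (f x) \<and> (\<forall>y. 0 \<le> f x y) \<and> f x x = 2 \<and>
      (\<exists>D e k k'. is_collar M B D e k k' \<and> C \<subseteq> D \<inter> B) \<and> compactin M C \<and> (\<forall>y \<in> B - C. f x y = 0)"
    by blast
  from bchoice[OF this] obtain C where "\<forall>x \<in> B. continuous_map M euclideanreal (f x) \<and> (\<forall>y. 0 \<le> f x y) \<and> f x x = 2 \<and>
      (\<exists>D e k k'. is_collar M B D e k k' \<and> C x \<subseteq> D \<inter> B) \<and> compactin M (C x) \<and> (\<forall>y \<in> B - C x. f x y = 0)"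
    by blast
  then have f: "\<And>x. x \<in> B \<Longrightarrow> continuous_map M euclideanreal (f x)"
      "\<And>x y. x \<in> B \<Longrightarrow> (0::real) \<le> f x y" "\<And>x. x \<in> B \<Longrightarrow> f x x = 2"
    and C: "\<And>x. x \<in> B \<Longrightarrow> \<exists>D e k k'. is_collar M B D e k k' \<and> C x \<subseteq> D \<inter> B"
      "\<And>x. x \<in> B \<Longrightarrow> compactin M (C x)" "\<And>x y. x \<in> B \<Longrightarrow> y \<in> B - C x \<Longrightarrow> f x y = 0"
    by blast+
  have cB: "compactin M B" using M B closedin_compact_space by blast
  define V where "V = (\<lambda>x. {y \<in> topspace M. f x y \<in> {1<..}})"
  have oV: "openin M (V x)" if "x \<in> B" for x
    unfolding V_def by (rule openin_continuous_map_preimage[OF f(1)[OF that]]) auto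
  have "B \<subseteq> \<Union>(V ` B)"
    using f(3) BM by (fastforce simp: V_def)
  then have "\<exists>\<F>. finite \<F> \<and> \<F> \<subseteq> V ` B \<and> B \<subseteq> \<Union>\<F>"
    using oV by (intro compactinD[OF cB]) auto
  then obtain F where F: "finite F" "F \<subseteq> B" "B \<subseteq> (\<Union>x \<in> F. V x)"
    using finite_subset_image[of _ V B] by metis
  \<comment> \<open>Over all of \<open>F\<close> the capped sum is \<open>1\<close> on
    \<open>B\<close>, because at each point of \<open>B\<close> some summand exceeds
    \<open>1\<close>.\<close>
  define a where "a = (\<lambda>F y. min 1 (\<Sum>x \<in> F. f x y))"
  have a: "continuous_map M euclideanreal (a G)" "\<And>y. 0 \<le> a G y" "\<And>y. a G y \<le> 1" if "G \<subseteq> B" "finite G" for G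
    using that f(1,2) unfolding a_def
    by (auto intro!: continuous_intros sum_nonneg simp: subset_iff)
  have "\<exists>h h'. homeomorphic_maps (subtopology ?P (below (a {}))) (subtopology ?P (below (a G))) h h' \<and>
      (\<forall>x \<in> B. h (x, 0) = (x, a G x))" if "finite G" "G \<subseteq> B" for G
    using that
  proof (induction G)
    case empty
    show ?case
      by (rule exI[of _ id], rule exI[of _ id]) (simp only: homeomorphic_maps_id, simp add: a_def)
  next
    case (insert x G)
    then obtain h h' where h: "homeomorphic_maps (subtopology ?P (below (a {}))) (subtopology ?P (below (a G))) h h'"
        "\<And>y. y \<in> B \<Longrightarrow> h (y, 0) = (y, a G y)"
      by auto
    obtain D e k k' where c: "is_collar M B D e k k'" "C x \<subseteq> D \<inter> B"
      using C(1)[of x] insert.prems by blast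
    have "a G y = a (insert x G) y" if "y \<in> B - C x" for y
      using C(3)[of x y] that insert by (simp add: a_def)
    then obtain g g' where g: "homeomorphic_maps (subtopology ?P (below (a G))) (subtopology ?P (below (a (insert x G)))) g g'"
        "\<And>y. y \<in> B \<Longrightarrow> g (y, a G y) = (y, a (insert x G) y)"
      using external_collar_stretch[OF M(2) BM c(1), of "a G" "a (insert x G)" "C x"]
        a[of G] a[of "insert x G"] C(2)[of x] c(2) insert by auto
    show ?case
      using homeomorphic_maps_compose[OF conjI[OF h(1) g(1)]] h(2) g(2)
      by - (rule exI[of _ "g \<circ> h"], rule exI[of _ "h' \<circ> g'"], simp add: o_def)
  qed
  from this[OF F(1,2)] obtain h h' where h: "homeomorphic_maps (subtopology ?P (below (a {}))) (subtopology ?P (below (a F))) h h'"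
      and hB: "\<And>x. x \<in> B \<Longrightarrow> h (x, 0) = (x, a F x)"
    by blast
  have a1: "a F x = 1" if x: "x \<in> B" for x
  proof -
    obtain z where z: "z \<in> F" "f z x > 1" using F(3) x unfolding V_def by blast
    have "f z x \<le> (\<Sum>x' \<in> F. f x' x)"
      using F(1,2) f(2) z by (intro member_le_sum) auto
    then show ?thesis using z by (simp add: a_def)
  qed
  have "subtopology ?P (below (a F)) = ?P"
  proof -
    have "topspace ?P \<subseteq> below (a F)"
      using a1 a(2)[OF F(2,1)] by (auto simp: external_collar_def below_def)
    then show ?thesis by (metis subtopology_superset)
  qed
  moreover have "homeomorphic_maps M (subtopology ?P (below (a {}))) (\<lambda>y. (y, 0)) fst"
    unfolding homeomorphic_maps_def
    by (auto simp: external_collar_def below_def a_def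
        intro!: continuous_map_into_subtopology continuous_map_from_subtopology continuous_map_pairedI continuous_map_fst)
  ultimately have H: "homeomorphic_maps M ?P (h \<circ> (\<lambda>y. (y, 0))) (fst \<circ> h')"
    using homeomorphic_maps_compose[OF conjI[OF _ h]] by metis
  define H where "H = h \<circ> (\<lambda>y. (y, 0::real))"
  define H' where "H' = fst \<circ> h'"
  have cH: "continuous_map M ?P H" and cH': "continuous_map ?P M H'"
    and HH: "\<And>y. y \<in> topspace M \<Longrightarrow> H' (H y) = y" "\<And>p. p \<in> topspace ?P \<Longrightarrow> H (H' p) = p"
    using H unfolding H_def H'_def homeomorphic_maps_def by blast+
  have HB: "H x = (x, 1)" if "x \<in> B" for x using that hB a1 by (simp add: H_def)
  have HP: "H y \<in> topspace ?P" if "y \<in> topspace M" for y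
    using continuous_map_image_subset_topspace[OF cH] that by blast
  have H'M: "H' p \<in> topspace M" if "p \<in> topspace ?P" for p
    using continuous_map_image_subset_topspace[OF cH'] that by blast
  \<comment> \<open>The part strictly above level \<open>0\<close>. Heights are measured by
    \<open>1 - snd\<close> because \<open>H\<close> puts \<open>B\<close> at level
    \<open>1\<close>.\<close>
  define D where "D = {y \<in> topspace M. H y \<in> {p \<in> topspace ?P. snd p \<in> {0<..}}}"
  have csnd: "continuous_map ?P euclideanreal snd"
  proof -
    have "continuous_map ?P (top_of_set {0..1::real}) snd"
      by (auto simp: external_collar_def intro!: continuous_map_from_subtopology continuous_map_snd)
    then show ?thesis by (simp add: continuous_map_in_subtopology)
  qed
  have cfst: "continuous_map ?P M fst"
    by (auto simp: external_collar_def intro!: continuous_map_from_subtopology continuous_map_fst)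
  have "openin M D"
    unfolding D_def
    by (intro openin_continuous_map_preimage[OF cH] openin_continuous_map_preimage[OF csnd]) auto
  have BD: "B \<subseteq> D" using HB BM by (auto simp: D_def external_collar_def)
  then have DB: "D \<inter> B = B" by blast
  have HD: "fst (H y) \<in> B" "0 < snd (H y)" "snd (H y) \<le> 1" if "y \<in> D" for y
    using that by (auto simp: D_def external_collar_def)
  let ?Z = "prod_topology (subtopology M B) (top_of_set {0..<1::real})"
  have c1: "continuous_map ?Z ?P (\<lambda>p. (fst p, 1 - snd p))"
  proof -
    have "continuous_map ?Z M fst"
      using continuous_map_fst[of "subtopology M B" "top_of_set {0..<1::real}"] by (simp add: continuous_map_in_subtopology)
    moreover have "continuous_map ?Z euclideanreal snd"
      using continuous_map_snd[of "subtopology M B" "top_of_set {0..<1::real}"] by (simp add: continuous_map_in_subtopology)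
    ultimately show ?thesis
      unfolding external_collar_def
      by (intro continuous_map_into_subtopology continuous_map_pairedI continuous_intros) auto
  qed
  have PZ: "(x, 1 - t) \<in> topspace ?P" if "x \<in> B" "0 \<le> t" "t < 1" for x t
    using that BM by (auto simp: external_collar_def)
  have "homeomorphic_maps ?Z (subtopology M D) (\<lambda>p. H' (fst p, 1 - snd p)) (\<lambda>y. (fst (H y), 1 - snd (H y)))"
    unfolding homeomorphic_maps_def
  proof (intro conjI ballI)
    show "continuous_map ?Z (subtopology M D) (\<lambda>p. H' (fst p, 1 - snd p))"
      by (rule continuous_map_into_subtopology[OF continuous_map_compose2[OF c1 cH']])
         (use PZ H'M HH in \<open>auto simp: D_def\<close>)
    have "continuous_map (subtopology M D) ?P H"
      using cH continuous_map_from_subtopology by blast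
    note compose2 = continuous_map_compose2[OF this]
    show "continuous_map (subtopology M D) ?Z (\<lambda>y. (fst (H y), 1 - snd (H y)))"
      by (intro continuous_map_pairedI continuous_map_into_subtopology continuous_intros
          compose2[OF cfst] compose2[OF csnd])
         (use HD in \<open>auto\<close>)
  next
    fix p assume "p \<in> topspace ?Z"
    then show "(fst (H (H' (fst p, 1 - snd p))), 1 - snd (H (H' (fst p, 1 - snd p)))) = p"
      using HH(2)[OF PZ] by (cases p) auto
  next
    fix y assume "y \<in> topspace (subtopology M D)"
    then show "H' (fst (fst (H y), 1 - snd (H y)), 1 - snd (fst (H y), 1 - snd (H y))) = y"
      using HH(1) by simp
  qed
  moreover have "H' (x, 1) = x" if "x \<in> B" for x
    using HH(1)[of x] HB[OF that] BM that by auto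
  ultimately show ?thesis
    using \<open>openin M D\<close> BD by (intro exI[of _ D] exI conjI) (auto simp: is_collar_def DB)
qed

section \<open>Charts and the boundary of a manifold\<close>

lemma homeomorphic_map_restrict_open:
  assumes f: "homeomorphic_map (subtopology X U) (subtopology Y V) f"
    and "openin X U" "openin Y V" "A \<subseteq> U" "openin X A"
  shows "openin Y (f ` A)" "f ` A \<subseteq> V" "homeomorphic_map (subtopology X A) (subtopology Y (f ` A)) f"
proof -
  have UX: "U \<subseteq> topspace X" and VY: "V \<subseteq> topspace Y" using assms openin_subset by blast+
  have im: "f ` U = V" using homeomorphic_imp_surjective_map[OF f] UX VY by (simp add: inf_absorb2)
  have "openin (subtopology Y V) (f ` A)"
    using homeomorphic_map_openness[OF f, of A] assms UX by (simp add: openin_open_subtopology inf_absorb2)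
  then show "openin Y (f ` A)" "f ` A \<subseteq> V" using assms by (auto simp: openin_open_subtopology)
  have e: "V \<inter> f ` A = f ` A" "U \<inter> A = A" using im assms(4) by auto
  have "homeomorphic_map (subtopology (subtopology X U) A) (subtopology (subtopology Y V) (f ` A)) f"
    by (rule homeomorphic_map_subtopologies[OF f]) (use UX VY im assms in auto)
  then show "homeomorphic_map (subtopology X A) (subtopology Y (f ` A)) f"
    by (simp add: subtopology_subtopology e)
qed

lemma homeomorphic_map_restrict:
  assumes f: "homeomorphic_map X Y f" and A: "A \<subseteq> topspace X"
  shows "homeomorphic_map (subtopology X A) (subtopology Y (f ` A)) f"
  by (rule homeomorphic_map_subtopologies[OF f])
     (use A homeomorphic_imp_surjective_map[OF f] in auto)

text \<open>The model \<open>E\<close> is left open: \<open>half_space n\<close> gives manifold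
  charts, \<open>Euclidean_space n\<close> detects interior points, and
  \<open>Euclidean_space (n - 1)\<close> serves for the boundary, all with the same transfer
  lemmas.\<close>

definition has_chart :: "'b topology \<Rightarrow> 'a topology \<Rightarrow> 'a \<Rightarrow> bool"
  where "has_chart E X x \<longleftrightarrow> (\<exists>U V. openin X U \<and> x \<in> U \<and> openin E V \<and>
     subtopology X U homeomorphic_space subtopology E V)"

lemma manifold_interior_iff: "x \<in> manifold_interior n X \<longleftrightarrow> x \<in> topspace X \<and> has_chart (Euclidean_space n) X x"
  by (simp add: manifold_interior_def has_chart_def)

lemma top_manifold_iff: "top_manifold n X \<longleftrightarrow>
    Hausdorff_space X \<and> second_countable X \<and> (\<forall>x \<in> topspace X. has_chart (half_space n) X x)"
  by (simp add: top_manifold_def has_chart_def)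

lemma has_chart_openin: "openin E W \<Longrightarrow> subtopology X A homeomorphic_space subtopology E W \<Longrightarrow> openin X A \<Longrightarrow> x \<in> A \<Longrightarrow> has_chart E X x"
  unfolding has_chart_def by blast

lemma has_chart_transfer:
  assumes f: "homeomorphic_map (subtopology X S) (subtopology Y T) f" and S: "openin X S" and T: "openin Y T"
    and x: "x \<in> S" and c: "has_chart E X x"
  shows "has_chart E Y (f x)"
proof -
  obtain U V where U: "openin X U" "x \<in> U" "openin E V" "subtopology X U homeomorphic_space subtopology E V"
    using c unfolding has_chart_def by blast
  then obtain h where h: "homeomorphic_map (subtopology X U) (subtopology E V) h"
    unfolding homeomorphic_space by blast
  let ?A = "U \<inter> S"
  have oA: "openin X ?A" using U S by blast
  note fA = homeomorphic_map_restrict_open[OF f S T _ oA]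
  note hA = homeomorphic_map_restrict_open[OF h U(1,3) _ oA]
  have "subtopology Y (f ` ?A) homeomorphic_space subtopology X ?A"
    using fA(3) homeomorphic_space homeomorphic_space_sym by blast
  also have "subtopology X ?A homeomorphic_space subtopology E (h ` ?A)"
    using hA(3) homeomorphic_space by blast
  finally show ?thesis
    using fA(1) hA(1) x U(2) unfolding has_chart_def by blast
qed

lemma has_chart_transfer_iff:
  assumes f: "homeomorphic_map (subtopology X S) (subtopology Y T) f" and S: "openin X S" and T: "openin Y T"
    and x: "x \<in> S"
  shows "has_chart E Y (f x) \<longleftrightarrow> has_chart E X x"
proof
  obtain g where g: "homeomorphic_maps (subtopology X S) (subtopology Y T) f g"
    using f homeomorphic_map_maps by blast
  have xS: "x \<in> topspace (subtopology X S)" using x openin_subset[OF S] by auto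
  have "homeomorphic_map (subtopology Y T) (subtopology X S) g" "g (f x) = x"
    using g xS unfolding homeomorphic_maps_map by blast+
  moreover have "f x \<in> T"
    using homeomorphic_imp_surjective_map[OF f] xS by auto
  ultimately show "has_chart E Y (f x) \<Longrightarrow> has_chart E X x"
    using has_chart_transfer[of Y T X S g "f x" E] S T by simp
qed (rule has_chart_transfer[OF assms])

lemma has_chart_subtopology_iff:
  assumes "openin X S" "x \<in> S"
  shows "has_chart E (subtopology X S) x \<longleftrightarrow> has_chart E X x"
proof -
  have "S \<subseteq> topspace X" using assms openin_subset by blast
  then have "homeomorphic_map (subtopology X S) (subtopology (subtopology X S) S) id"
    by (simp add: subtopology_subtopology)
  then show ?thesis
    using has_chart_transfer_iff[of X S "subtopology X S" S id x E] assms by (simp add: openin_open_subtopology)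
qed

lemma has_chart_model:
  assumes c: "has_chart E X x" and W: "openin E' W" and f: "E homeomorphic_space subtopology E' W"
  shows "has_chart E' X x"
proof -
  obtain U V where U: "openin X U" "x \<in> U" "openin E V" "subtopology X U homeomorphic_space subtopology E V"
    using c unfolding has_chart_def by blast
  obtain h where h: "homeomorphic_map (subtopology E (topspace E)) (subtopology E' W) h"
    using f unfolding homeomorphic_space by auto
  note hV = homeomorphic_map_restrict_open[OF h openin_topspace W openin_subset[OF U(3)] U(3)]
  have "subtopology X U homeomorphic_space subtopology E' (h ` V)"
    using U(4) hV(3) homeomorphic_space homeomorphic_space_trans by blast
  then show ?thesis using hV(1) U unfolding has_chart_def by blast
qed

section \<open>Euclidean space and half-space in coordinates, and invariance of the boundary\<close>

lemma continuous_map_Euclidean_space_iff_coords: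
  "continuous_map X (Euclidean_space n) f \<longleftrightarrow>
    (\<forall>i. continuous_map X euclideanreal (\<lambda>x. f x i)) \<and> (\<forall>x \<in> topspace X. \<forall>i\<ge>n. f x i = 0)"
  by (auto simp: Euclidean_space_def continuous_map_in_subtopology continuous_map_componentwise_UNIV)

lemma continuous_map_half_space_iff_coords:
  "continuous_map X (half_space n) f \<longleftrightarrow>
    (\<forall>i. continuous_map X euclideanreal (\<lambda>x. f x i)) \<and> (\<forall>x \<in> topspace X. (\<forall>i\<ge>n. f x i = 0) \<and> 0 \<le> f x 0)"
  by (auto simp: half_space_def continuous_map_in_subtopology continuous_map_Euclidean_space_iff_coords)

lemma topspace_half_space: "topspace (half_space n) = {x. (\<forall>i\<ge>n. x i = 0) \<and> 0 \<le> x 0}"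
  by (auto simp: half_space_def topspace_Euclidean_space)

lemma continuous_map_Euclidean_coord: "continuous_map (Euclidean_space n) euclideanreal (\<lambda>x. x i)"
  using continuous_map_Euclidean_space_iff_coords[of "Euclidean_space n" n id] by (simp add: o_def id_def)

lemma continuous_map_half_space_coord: "continuous_map (half_space n) euclideanreal (\<lambda>x. x i)"
  using continuous_map_half_space_iff_coords[of "half_space n" n id] by (simp add: o_def id_def)

text \<open>Perturb coordinate \<open>0\<close> alone; for \<open>n >= 1\<close> this stays in
  \<open>Euclidean_space n\<close>. It is the obstruction that keeps points of the bounding
  hyperplane from being interior points.\<close>

lemma Euclidean_open_not_in_half_space:
  assumes n: "n \<ge> 1" and S: "openin (Euclidean_space n) S" "p \<in> S" "p 0 = 0"
  shows "\<exists>q \<in> S. q 0 < 0"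
proof -
  have p: "\<forall>i\<ge>n. p i = 0" using openin_subset[OF S(1)] S(2) by (auto simp: topspace_Euclidean_space)
  have "continuous_map euclideanreal (Euclidean_space n) (\<lambda>t. p(0 := t))"
    unfolding continuous_map_Euclidean_space_iff_coords using n p
    by (auto simp: fun_upd_def)
  from openin_continuous_map_preimage[OF this S(1)]
  have o: "open {t. p(0 := t) \<in> S}" by simp
  have "0 \<in> {t. p(0 := t) \<in> S}" using S(2) fun_upd_triv[of p 0] S(3) by simp
  then obtain e where e: "e > 0" "ball 0 e \<subseteq> {t. p(0 := t) \<in> S}"
    using o openE by blast
  then have "-e/2 \<in> ball 0 e" by simp
  then have "p(0 := -e/2) \<in> S" using e by blast
  then show ?thesis using e by (intro bexI[of _ "p(0 := -e/2)"]) auto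
qed

text \<open>If \<open>0 < f x 0\<close>, a small neighbourhood of \<open>x\<close> is mapped off the
  hyperplane, hence onto a Euclidean open set. If \<open>x\<close> has a Euclidean chart, invariance
  of domain makes the \<open>f\<close>-image of a neighbourhood open in Euclidean space; as it lies
  in the half-space, it cannot meet the hyperplane.\<close>

lemma manifold_interior_chart_iff:
  assumes n: "n \<ge> 1" and U: "openin X U" and V: "openin (half_space n) V"
    and f: "homeomorphic_maps (subtopology X U) (subtopology (half_space n) V) f g" and x: "x \<in> U"
  shows "x \<in> manifold_interior n X \<longleftrightarrow> 0 < f x 0"
proof
  have fm: "homeomorphic_map (subtopology X U) (subtopology (half_space n) V) f"
    using f homeomorphic_maps_map by blast
  have UX: "U \<subseteq> topspace X" using U openin_subset by blast
  have VH: "V \<subseteq> topspace (half_space n)" using V openin_subset by blast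
  have fU: "f y \<in> V" if "y \<in> U" for y
    using homeomorphic_imp_surjective_map[OF fm] UX VH that by auto
  {
    assume "0 < f x 0"
    define A where "A = {y \<in> U. f y \<in> {v \<in> topspace (half_space n). v 0 \<in> {0<..}}}"
    have "continuous_map (subtopology X U) (half_space n) f"
      using homeomorphic_imp_continuous_map[OF fm] continuous_map_into_fulltopology by blast
    from openin_continuous_map_preimage[OF this openin_continuous_map_preimage[OF continuous_map_half_space_coord[of n 0]], of "{0<..}"]
    have "openin (subtopology X U) {y \<in> topspace (subtopology X U). f y \<in> {v \<in> topspace (half_space n). v 0 \<in> {0<..}}}"
      by simp
    moreover have "topspace (subtopology X U) = U" using UX by auto
    ultimately have "openin (subtopology X U) A"
      unfolding A_def by metis
    then have oA: "openin X A" using U by (simp add: openin_open_subtopology)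
    note fA = homeomorphic_map_restrict_open[OF fm U V _ oA]
    have AU: "A \<subseteq> U" by (auto simp: A_def)
    obtain S where S: "openin (Euclidean_space n) S" "f ` A = S \<inter> {x. 0 \<le> x 0}"
      using fA(1)[OF AU] unfolding half_space_def openin_subtopology by blast
    \<comment> \<open>Off the hyperplane the closed condition \<open>0 <= v 0\<close> may be
      replaced by the open condition \<open>0 < v 0\<close>, so openness in the half-space becomes
      openness in the full space.\<close>
    have "f ` A = S \<inter> {v \<in> topspace (Euclidean_space n). v 0 \<in> {0<..}}"
    proof -
      have "\<And>v. v \<in> f ` A \<Longrightarrow> v 0 > 0" by (auto simp: A_def)
      then show ?thesis using S(2) openin_subset[OF S(1)] by fastforce
    qed
    moreover have "openin (Euclidean_space n) {v \<in> topspace (Euclidean_space n). v 0 \<in> {0<..}}"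
      by (rule openin_continuous_map_preimage[OF continuous_map_Euclidean_coord]) auto
    ultimately have o: "openin (Euclidean_space n) (f ` A)" using S(1) by auto
    have "subtopology (half_space n) (f ` A) = subtopology (Euclidean_space n) (f ` A)"
      using S(2) by (simp add: half_space_def subtopology_subtopology Int_ac)
    then have "subtopology X A homeomorphic_space subtopology (Euclidean_space n) (f ` A)"
      using fA(3)[OF AU] homeomorphic_space by metis
    moreover have "x \<in> A" using x \<open>0 < f x 0\<close> fU VH by (auto simp: A_def)
    ultimately show "x \<in> manifold_interior n X"
      unfolding manifold_interior_iff has_chart_def using o oA UX x by blast
  }
  {
    assume "x \<in> manifold_interior n X"
    then obtain U2 V2 h where U2: "openin X U2" "x \<in> U2" and V2: "openin (Euclidean_space n) V2"
      and h: "homeomorphic_map (subtopology X U2) (subtopology (Euclidean_space n) V2) h"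
      unfolding manifold_interior_iff has_chart_def homeomorphic_space by blast
    define A where "A = U \<inter> U2"
    have A: "openin X A" "A \<subseteq> U" "A \<subseteq> U2" "x \<in> A" using U U2 x by (auto simp: A_def)
    note hA = homeomorphic_map_restrict_open[OF h U2(1) V2 A(3,1)]
    obtain h' where h': "homeomorphic_maps (subtopology X A) (subtopology (Euclidean_space n) (h ` A)) h h'"
      using hA(3) homeomorphic_map_maps by blast
    have AX: "A \<subseteq> topspace X" using A(2) UX by blast
    have h'h: "h' (h y) = y" if "y \<in> A" for y using h' that AX unfolding homeomorphic_maps_def by auto
    have "continuous_map (subtopology X A) (half_space n) f"
      using homeomorphic_imp_continuous_map[OF fm] A(2) continuous_map_from_subtopology_mono continuous_map_into_fulltopology by metis
    then have "continuous_map (subtopology X A) (Euclidean_space n) f"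
      unfolding half_space_def using continuous_map_into_fulltopology by blast
    \<comment> \<open>The change from the Euclidean to the half-space chart, read as a map into the
      full space so that invariance of domain applies.\<close>
    then have "continuous_map (subtopology (Euclidean_space n) (h ` A)) (Euclidean_space n) (f \<circ> h')"
      using h' continuous_map_compose unfolding homeomorphic_maps_def by blast
    moreover have "inj_on (f \<circ> h') (h ` A)"
    proof -
      have "inj_on f U" using fm UX unfolding homeomorphic_eq_everything_map by (simp add: inf_absorb2)
      then show ?thesis
        using A(2) h'h by (auto simp: inj_on_def subset_iff)
    qed
    ultimately have "openin (Euclidean_space n) ((f \<circ> h') ` h ` A)"
      using invariance_of_domain_Euclidean_space hA(1) by blast
    moreover have "(f \<circ> h') ` h ` A = f ` A" using h'h by force
    ultimately have "openin (Euclidean_space n) (f ` A)" by simp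
    moreover have "\<forall>q \<in> f ` A. q 0 \<ge> 0"
      using fU A(2) VH by (auto simp: topspace_half_space)
    ultimately have "f x 0 \<noteq> 0"
      using Euclidean_open_not_in_half_space[OF n, of "f ` A" "f x"] A(4) by force
    then show "0 < f x 0" using fU[OF x] VH by (auto simp: topspace_half_space less_le)
  }
qed

lemma openin_manifold_interior: "openin X (manifold_interior n X)"
proof (subst openin_subopen, intro ballI)
  fix x assume "x \<in> manifold_interior n X"
  then obtain U V where U: "openin X U" "x \<in> U" "openin (Euclidean_space n) V"
      "subtopology X U homeomorphic_space subtopology (Euclidean_space n) V"
    unfolding manifold_interior_iff has_chart_def by blast
  have "U \<subseteq> manifold_interior n X"
  proof
    fix y assume "y \<in> U"
    then show "y \<in> manifold_interior n X"
      unfolding manifold_interior_iff using has_chart_openin[OF U(3,4,1)] openin_subset[OF U(1)] by blast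
  qed
  then show "\<exists>T. openin X T \<and> x \<in> T \<and> T \<subseteq> manifold_interior n X" using U by blast
qed

lemma closedin_manifold_boundary: "closedin X (manifold_boundary n X)"
  unfolding manifold_boundary_def using openin_manifold_interior by blast

text \<open>Through \<open>has_chart_model\<close> this turns Euclidean charts into the half-space
  charts that \<open>top_manifold\<close> asks for.\<close>

lemma Euclidean_space_homeomorphic_open_half_space:
  assumes "n \<ge> 1"
  shows "openin (half_space n) {x \<in> topspace (half_space n). x 0 \<in> {0<..}}"
    and "Euclidean_space n homeomorphic_space subtopology (half_space n) {x \<in> topspace (half_space n). x 0 \<in> {0<..}}"
proof -
  let ?W = "{x \<in> topspace (half_space n). x 0 \<in> {0<..}}"
  show "openin (half_space n) ?W"
    by (rule openin_continuous_map_preimage[OF continuous_map_half_space_coord]) auto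
  have "homeomorphic_maps (Euclidean_space n) (subtopology (half_space n) ?W)
      (\<lambda>x. x(0 := exp (x 0))) (\<lambda>x. x(0 := ln (x 0)))"
    unfolding homeomorphic_maps_def
  proof (intro conjI ballI)
    have c: "continuous_map (Euclidean_space n) euclideanreal (\<lambda>x. exp (x 0))"
      using continuous_map_compose[OF continuous_map_Euclidean_coord[of n 0], of euclideanreal exp]
      by (simp add: o_def continuous_on_exp)
    have "continuous_map (Euclidean_space n) euclideanreal (\<lambda>x. (x(0 := exp (x 0))) i)" for i
      using c continuous_map_Euclidean_coord[of n i] by (cases "i = 0") auto
    then show "continuous_map (Euclidean_space n) (subtopology (half_space n) ?W) (\<lambda>x. x(0 := exp (x 0)))"
      using assms
      by (auto simp: continuous_map_in_subtopology continuous_map_half_space_iff_coords topspace_half_space topspace_Euclidean_space)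
    have c0: "continuous_map (subtopology (half_space n) ?W) euclideanreal (\<lambda>x. x i)" for i
      using continuous_map_half_space_coord continuous_map_from_subtopology by blast
    have "continuous_map (subtopology (half_space n) ?W) (top_of_set {0<..}) (\<lambda>x. x 0)"
      using c0 by (auto simp: continuous_map_in_subtopology)
    then have c: "continuous_map (subtopology (half_space n) ?W) euclideanreal (\<lambda>x. ln (x 0))"
      using continuous_map_compose[of _ "top_of_set {0<..}" "\<lambda>x. x 0" euclideanreal ln]
      by (force simp: o_def intro: continuous_on_ln continuous_on_id)
    have "continuous_map (subtopology (half_space n) ?W) euclideanreal (\<lambda>x. (x(0 := ln (x 0))) i)" for i
      using c c0[of i] by (cases "i = 0") auto
    then show "continuous_map (subtopology (half_space n) ?W) (Euclidean_space n) (\<lambda>x. x(0 := ln (x 0)))"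
      using assms
      by (auto simp: continuous_map_Euclidean_space_iff_coords topspace_half_space)
  qed auto
  then show "Euclidean_space n homeomorphic_space subtopology (half_space n) ?W"
    using homeomorphic_space_def by blast
qed

lemma half_space_boundary_homeomorphic_Euclidean_space:
  assumes "n \<ge> 1"
  shows "subtopology (half_space n) {y. y 0 = 0} homeomorphic_space Euclidean_space (n - 1)"
proof -
  let ?S = "subtopology (half_space n) {y. y 0 = 0}"
  have "homeomorphic_maps ?S (Euclidean_space (n - 1)) (\<lambda>y i. y (Suc i)) (\<lambda>z i. case i of 0 \<Rightarrow> 0 | Suc j \<Rightarrow> z j)"
    unfolding homeomorphic_maps_def
  proof (intro conjI ballI)
    show "continuous_map ?S (Euclidean_space (n - 1)) (\<lambda>y i. y (Suc i))"
      unfolding continuous_map_Euclidean_space_iff_coords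
      using continuous_map_from_subtopology[OF continuous_map_half_space_coord[of n]]
      by (auto simp: topspace_half_space)
    have "continuous_map (Euclidean_space (n - 1)) euclideanreal (\<lambda>z. case i of 0 \<Rightarrow> 0 | Suc j \<Rightarrow> z j)" for i
      by (cases i) (auto simp: continuous_map_Euclidean_coord)
    then show "continuous_map (Euclidean_space (n - 1)) ?S (\<lambda>z i. case i of 0 \<Rightarrow> 0 | Suc j \<Rightarrow> z j)"
      using assms
      by (auto simp: continuous_map_in_subtopology continuous_map_half_space_iff_coords topspace_Euclidean_space split: nat.split)
  next
    fix y assume "y \<in> topspace ?S"
    then show "(\<lambda>i. case i of 0 \<Rightarrow> 0 | Suc j \<Rightarrow> y (Suc j)) = y"
      by (auto simp: fun_eq_iff split: nat.split)
  qed auto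
  then show ?thesis using homeomorphic_space_def by blast
qed

text \<open>By \<open>manifold_interior_chart_iff\<close> a half-space chart takes the boundary to
  the hyperplane where coordinate \<open>0\<close> vanishes, and shifting coordinates makes that
  \<open>Euclidean_space (n - 1)\<close>.\<close>

lemma has_chart_manifold_boundary:
  assumes n: "n \<ge> 1" and X: "top_manifold n X" and b: "b \<in> manifold_boundary n X"
  shows "has_chart (Euclidean_space (n - 1)) (subtopology X (manifold_boundary n X)) b"
proof -
  let ?B = "manifold_boundary n X"
  have bX: "b \<in> topspace X" using b by (simp add: manifold_boundary_def)
  then obtain U V f g where U: "openin X U" "b \<in> U" and V: "openin (half_space n) V"
    and f: "homeomorphic_maps (subtopology X U) (subtopology (half_space n) V) f g"
    using X unfolding top_manifold_def homeomorphic_space_def by blast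
  have fm: "homeomorphic_map (subtopology X U) (subtopology (half_space n) V) f"
    using f homeomorphic_maps_map by blast
  have UX: "U \<subseteq> topspace X" using U openin_subset by blast
  have VH: "V \<subseteq> topspace (half_space n)" using V openin_subset by blast
  have fU: "f ` U = V"
    using homeomorphic_imp_surjective_map[OF fm] UX VH by auto
  let ?H = "{y. y 0 = (0::real)} :: (nat \<Rightarrow> real) set"
  have B: "y \<in> ?B \<longleftrightarrow> f y \<in> ?H" if "y \<in> U" for y
  proof -
    have "f y \<in> topspace (half_space n)" using fU that VH by blast
    then show ?thesis
      using manifold_interior_chart_iff[OF n U(1) V f that] that UX
      by (auto simp: manifold_boundary_def topspace_half_space)
  qed
  have "f ` (topspace (subtopology X U) \<inter> ?B) = topspace (subtopology (half_space n) V) \<inter> ?H"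
    using B fU UX VH by auto
  from homeomorphic_map_subtopologies[OF fm this]
  have 1: "subtopology (subtopology X ?B) U homeomorphic_space subtopology (subtopology (half_space n) ?H) V"
    unfolding homeomorphic_space by (auto simp: subtopology_subtopology inf_commute)
  obtain s where s: "homeomorphic_map (subtopology (half_space n) ?H) (Euclidean_space (n - 1)) s"
    using half_space_boundary_homeomorphic_Euclidean_space[OF n] homeomorphic_space by blast
  let ?V = "V \<inter> ?H"
  have oV: "openin (subtopology (half_space n) ?H) ?V"
    using V by (simp add: openin_subtopology_Int)
  have "subtopology (subtopology X ?B) U homeomorphic_space subtopology (subtopology (half_space n) ?H) ?V"
    using 1 by (simp add: subtopology_subtopology Int_ac)
  also have "subtopology (subtopology (half_space n) ?H) ?V homeomorphic_space subtopology (Euclidean_space (n - 1)) (s ` ?V)"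
    using homeomorphic_map_restrict[OF s openin_subset[OF oV]] homeomorphic_space by blast
  finally have 2: "subtopology (subtopology X ?B) (U \<inter> ?B) homeomorphic_space subtopology (Euclidean_space (n - 1)) (s ` ?V)"
    by (simp add: subtopology_subtopology Int_ac)
  have "openin (Euclidean_space (n - 1)) (s ` ?V)"
    using homeomorphic_map_openness[OF s, of ?V] oV openin_subset[OF oV] by simp
  moreover have "openin (subtopology X ?B) (U \<inter> ?B)" using U by (simp add: openin_subtopology_Int)
  ultimately show ?thesis using 2 U(2) b unfolding has_chart_def by blast
qed

text \<open>Euclidean charts at all points leave no boundary. To become half-space charts they are
  moved into the open half-space, which takes \<open>n - 1 >= 1\<close>.\<close>

lemma closed_top_manifold_boundary:
  assumes n: "n \<ge> 2" and X: "top_manifold n X" and c: "compact_space X"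
  shows "closed_top_manifold (n - 1) (subtopology X (manifold_boundary n X))"
proof -
  let ?B = "subtopology X (manifold_boundary n X)"
  have h: "has_chart (Euclidean_space (n - 1)) ?B b" if "b \<in> topspace ?B" for b
    using has_chart_manifold_boundary[OF _ X, of b] n that by auto
  have "has_chart (half_space (n - 1)) ?B b" if "b \<in> topspace ?B" for b
    using has_chart_model[OF h[OF that] Euclidean_space_homeomorphic_open_half_space] n by simp
  moreover have "compact_space ?B"
    using c closedin_manifold_boundary by (metis closedin_compact_space compact_space_subtopology)
  moreover have "manifold_boundary (n - 1) ?B = {}"
    using h by (auto simp: manifold_boundary_def manifold_interior_iff)
  moreover have "Hausdorff_space ?B" "second_countable ?B"
    using X by (auto simp: top_manifold_def Hausdorff_space_subtopology second_countable_subtopology)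
  ultimately show ?thesis
    unfolding closed_top_manifold_def top_manifold_iff by blast
qed

section \<open>Collars of manifolds\<close>

text \<open>In a chart, coordinate \<open>0\<close> is the height of a point, and resetting it to
  \<open>0\<close> gives its foot. \<open>D\<close> consists of the points with foot in
  \<open>Q\<close> and height below \<open>e\<close>, where the box \<open>Q x [0, e)\<close> is
  small enough that all vertical lifts stay in the range \<open>V\<close> of the chart.\<close>

lemma manifold_local_collar:
  assumes n: "n \<ge> 1" and X: "top_manifold n X" and b: "b \<in> manifold_boundary n X"
  shows "\<exists>D e k k'. b \<in> D \<and> is_collar X (manifold_boundary n X) D e k k'"
proof -
  let ?B = "manifold_boundary n X"
  have bX: "b \<in> topspace X" using b by (simp add: manifold_boundary_def)
  then obtain U V f g where U: "openin X U" "b \<in> U" and V: "openin (half_space n) V"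
    and f: "homeomorphic_maps (subtopology X U) (subtopology (half_space n) V) f g"
    using X unfolding top_manifold_def homeomorphic_space_def by blast
  have UX: "U \<subseteq> topspace X" using U openin_subset by blast
  have VH: "V \<subseteq> topspace (half_space n)" using V openin_subset by blast
  have topU: "topspace (subtopology X U) = U" and topV: "topspace (subtopology (half_space n) V) = V"
    using UX VH by auto
  have cf: "continuous_map (subtopology X U) (subtopology (half_space n) V) f"
    and cg: "continuous_map (subtopology (half_space n) V) (subtopology X U) g"
    and gf: "\<And>y. y \<in> U \<Longrightarrow> g (f y) = y" and fg: "\<And>v. v \<in> V \<Longrightarrow> f (g v) = v"
    using f unfolding homeomorphic_maps_def topU topV by blast+
  have fV: "f y \<in> V" if "y \<in> U" for y
    using continuous_map_image_subset_topspace[OF cf] that unfolding topU topV by blast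
  have gU: "g v \<in> U" if "v \<in> V" for v
    using continuous_map_image_subset_topspace[OF cg] that unfolding topU topV by blast
  have f0: "0 \<le> f y 0" if "y \<in> U" for y
    using fV[OF that] VH by (auto simp: topspace_half_space)
  have B: "y \<in> ?B \<longleftrightarrow> f y 0 = 0" if "y \<in> U" for y
    using manifold_interior_chart_iff[OF n U(1) V f that] f0[OF that] that UX
    by (auto simp: manifold_boundary_def)
  let ?H = "prod_topology (half_space n) (top_of_set {0::real..})"
  have upd: "continuous_map ?H (half_space n) (\<lambda>p. (fst p)(0 := snd p))"
  proof -
    have "continuous_map ?H euclideanreal snd"
      using continuous_map_snd[of "half_space n" "top_of_set {0::real..}"] by (simp add: continuous_map_in_subtopology)
    moreover have "continuous_map ?H euclideanreal (\<lambda>p. fst p i)" for i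
      by (rule continuous_map_compose2[OF continuous_map_fst continuous_map_half_space_coord])
    ultimately have "continuous_map ?H euclideanreal (\<lambda>p. ((fst p)(0 := snd p)) i)" for i
      by (cases "i = 0") auto
    then show ?thesis
      using n unfolding continuous_map_half_space_iff_coords by (auto simp: topspace_half_space)
  qed
  \<comment> \<open>The foots and heights whose lift stays in \<open>V\<close>; a product
    neighbourhood of \<open>(f b, 0)\<close> in this open set yields \<open>Q\<close> and
    \<open>e\<close>.\<close>
  define S where "S = {p \<in> topspace ?H. (fst p)(0 := snd p) \<in> V}"
  have "openin ?H S"
    unfolding S_def by (rule openin_continuous_map_preimage[OF upd V])
  moreover have "(f b, 0) \<in> S"
    using B[OF U(2)] b fV[OF U(2)] VH fun_upd_triv[of "f b" 0] by (auto simp: S_def)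
  ultimately have "\<exists>Q T. openin (half_space n) Q \<and> openin (top_of_set {0::real..}) T \<and> f b \<in> Q \<and> 0 \<in> T \<and> Q \<times> T \<subseteq> S"
    unfolding openin_prod_topology_alt by (elim allE impE)
  then obtain Q T where Q: "openin (half_space n) Q" "f b \<in> Q" and T: "openin (top_of_set {0::real..}) T" "0 \<in> T"
    and QT: "Q \<times> T \<subseteq> {p \<in> topspace ?H. (fst p)(0 := snd p) \<in> V}"
    unfolding S_def by (elim exE conjE)
  obtain e where e: "e > 0" "\<And>t. 0 \<le> t \<Longrightarrow> t < e \<Longrightarrow> t \<in> T"
  proof -
    obtain S where S: "open S" "T = S \<inter> {0..}" using T by (auto simp: openin_subtopology)
    then obtain e where "e > 0" "ball 0 e \<subseteq> S" using T openE by blast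
    then show ?thesis using S by (intro that[of e]) (auto simp: subset_iff dist_real_def)
  qed
  have QV: "q(0 := t) \<in> V" if "q \<in> Q" "0 \<le> t" "t < e" for q t
  proof -
    have "(q, t) \<in> Q \<times> T" using that e(2) by simp
    from subsetD[OF QT this] show ?thesis by simp
  qed
  let ?p = "\<lambda>y. (f y)(0 := 0 :: real)"
  have cfH: "continuous_map (subtopology X U) (half_space n) f" using cf continuous_map_into_fulltopology by blast
  have cp: "continuous_map (subtopology X U) (half_space n) ?p"
  proof -
    have "continuous_map (subtopology X U) ?H (\<lambda>y. (f y, 0))"
      by (intro continuous_map_pairedI cfH) auto
    from continuous_map_compose2[OF this upd] show ?thesis by simp
  qed
  have c0: "continuous_map (subtopology X U) euclideanreal (\<lambda>y. f y 0)"
    by (rule continuous_map_compose2[OF cfH continuous_map_half_space_coord])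
  define D where "D = {y \<in> U. ?p y \<in> Q \<and> f y 0 \<in> {..<e}}"
  have "openin (subtopology X U) ({y \<in> U. ?p y \<in> Q} \<inter> {y \<in> U. f y 0 \<in> {..<e}})"
    using openin_continuous_map_preimage[OF cp Q(1)] openin_continuous_map_preimage[OF c0, of "{..<e}"]
    unfolding topU by (intro openin_Int) auto
  moreover have "{y \<in> U. ?p y \<in> Q} \<inter> {y \<in> U. f y 0 \<in> {..<e}} = D" by (auto simp: D_def)
  ultimately have oD: "openin X D" using U(1) by (simp add: openin_open_subtopology)
  have DU: "D \<subseteq> U" by (auto simp: D_def)
  have bD: "b \<in> D"
    using B[OF U(2)] b Q(2) U(2) e(1) fun_upd_triv[of "f b" 0] by (auto simp: D_def)
  have DB: "y \<in> U" "f y 0 = 0" "f y \<in> Q" "?p y = f y" if "y \<in> D \<inter> ?B" for y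
  proof -
    show 1: "y \<in> U" "f y 0 = 0" using that B DU by auto
    show "?p y = f y" using 1 fun_upd_triv[of "f y" 0] by simp
    then show "f y \<in> Q" using that by (auto simp: D_def)
  qed
  let ?Z = "prod_topology (subtopology X (D \<inter> ?B)) (top_of_set {0..<e})"
  let ?k = "\<lambda>z. g ((f (fst z))(0 := snd z))"
  let ?k' = "\<lambda>y. (g (?p y), f y 0)"
  have kV: "(f x)(0 := t) \<in> V" if "x \<in> D \<inter> ?B" "0 \<le> t" "t < e" for x t
    using QV DB that by blast
  have kD: "?k (x, t) \<in> D" if "x \<in> D \<inter> ?B" "0 \<le> t" "t < e" for x t
    using gU[OF kV[OF that]] fg[OF kV[OF that]] DB[OF that(1)] that by (simp add: D_def)
  have pV: "?p y \<in> V" if "y \<in> D" for y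
    using QV[of "?p y" 0] that e(1) by (simp add: D_def)
  have "homeomorphic_maps ?Z (subtopology X D) ?k ?k'"
    unfolding homeomorphic_maps_def
  proof (intro conjI ballI)
    have 1: "continuous_map ?Z (subtopology X U) fst"
      using continuous_map_fst[of "subtopology X (D \<inter> ?B)" "top_of_set {0..<e}"] DU
      by (auto simp: continuous_map_in_subtopology)
    have 2: "continuous_map ?Z (top_of_set {0..}) snd"
      using continuous_map_snd[of "subtopology X (D \<inter> ?B)" "top_of_set {0..<e}"]
      by (auto simp: continuous_map_in_subtopology)
    have "continuous_map ?Z ?H (\<lambda>z. (f (fst z), snd z))"
      by (intro continuous_map_pairedI continuous_map_compose2[OF 1 cfH] 2)
    from continuous_map_compose2[OF this upd]
    have "continuous_map ?Z (subtopology (half_space n) V) (\<lambda>z. (f (fst z))(0 := snd z))"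
      using kV by (intro continuous_map_into_subtopology) auto
    from continuous_map_compose2[OF this cg]
    have "continuous_map ?Z X ?k"
      by (simp add: continuous_map_in_subtopology)
    then show "continuous_map ?Z (subtopology X D) ?k"
      using kD by (intro continuous_map_into_subtopology) auto
    have "continuous_map (subtopology X D) (subtopology (half_space n) V) ?p"
      using pV by (intro continuous_map_into_subtopology continuous_map_from_subtopology_mono[OF cp DU]) auto
    from continuous_map_compose2[OF this cg]
    have "continuous_map (subtopology X D) X (\<lambda>y. g (?p y))"
      by (simp add: continuous_map_in_subtopology)
    moreover have "g (?p y) \<in> D \<inter> ?B" if "y \<in> D" for y
      using gU[OF pV[OF that]] fg[OF pV[OF that]] B[OF gU[OF pV[OF that]]] that e(1) by (simp add: D_def)
    moreover have "continuous_map (subtopology X D) euclideanreal (\<lambda>y. f y 0)"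
      using c0 DU continuous_map_from_subtopology_mono by blast
    moreover have "f y 0 \<in> {0..<e}" if "y \<in> D" for y
      using that f0 by (auto simp: D_def)
    ultimately show "continuous_map (subtopology X D) ?Z ?k'"
      by (intro continuous_map_pairedI continuous_map_into_subtopology) auto
  next
    fix z assume "z \<in> topspace ?Z"
    then obtain x t where z: "z = (x, t)" "x \<in> D \<inter> ?B" "0 \<le> t" "t < e" by auto
    show "?k' (?k z) = z"
      using fg[OF kV[OF z(2-4)]] gf[OF DB(1)[OF z(2)]] DB(4)[OF z(2)] by (simp add: z(1))
  next
    fix y assume "y \<in> topspace (subtopology X D)"
    then have y: "y \<in> D" by simp
    show "?k (?k' y) = y"
      using fg[OF pV[OF y]] gf[of y] DU y by auto
  qed
  moreover have "\<forall>x \<in> D \<inter> ?B. ?k (x, 0) = x"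
    using DB gf by simp
  ultimately show ?thesis
    using oD bD e(1) unfolding is_collar_def
    by (intro exI[of _ D] exI[of _ e]) auto
qed

lemma manifold_collar:
  assumes "n \<ge> 1" "top_manifold n X" "compact_space X"
  shows "\<exists>D k k'. manifold_boundary n X \<subseteq> D \<and> is_collar X (manifold_boundary n X) D 1 k k'"
  using assms collar_exists[OF _ _ closedin_manifold_boundary manifold_local_collar]
  by (metis top_manifold_def)

section \<open>Cutting collars at a level\<close>

lemma homeomorphic_maps_restrict:
  assumes "homeomorphic_maps (subtopology X S) (subtopology Y T) f g" and "A \<subseteq> S" "S \<subseteq> topspace X"
  shows "homeomorphic_maps (subtopology X A) (subtopology Y (f ` A)) f g"
proof -
  have gf: "\<And>x. x \<in> A \<Longrightarrow> g (f x) = x" and fT: "f ` A \<subseteq> T"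
    using assms unfolding homeomorphic_maps_def continuous_map_def by (auto simp: Pi_iff subset_iff)
  have "homeomorphic_maps (subtopology (subtopology X S) A) (subtopology (subtopology Y T) (f ` A)) f g"
    by (rule homeomorphic_maps_subtopologies_alt[OF assms(1)]) (use gf in auto)
  moreover have "S \<inter> A = A" "T \<inter> f ` A = f ` A" using assms(2) fT by auto
  ultimately show ?thesis by (simp add: subtopology_subtopology)
qed

lemma collar_restrict:
  assumes c: "is_collar X B D 1 k k'" and B: "B \<subseteq> D" and J: "J \<subseteq> {0..<1}"
  shows "homeomorphic_maps (prod_topology (subtopology X B) (top_of_set J)) (subtopology X (k ` (B \<times> J))) k k'"
proof -
  have oD: "openin X D" and k: "homeomorphic_maps (prod_topology (subtopology X (D \<inter> B)) (top_of_set {0..<1})) (subtopology X D) k k'"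
    using c by (auto simp: is_collar_def)
  have DB: "D \<inter> B = B" using B by blast
  have BX: "B \<subseteq> topspace X" using B openin_subset[OF oD] by blast
  have k: "homeomorphic_maps (subtopology (prod_topology X euclideanreal) (B \<times> {0..<1})) (subtopology X D) k k'"
    using k unfolding DB by (simp add: subtopology_Times)
  show ?thesis
    using homeomorphic_maps_restrict[OF k, of "B \<times> J"] J BX by (auto simp: subtopology_Times)
qed

lemma collar_restrict_open:
  assumes c: "is_collar X B D 1 k k'" and B: "B \<subseteq> D" and e: "e \<le> 1"
  shows "openin X (k ` (B \<times> {0..<e}))"
proof -
  have oD: "openin X D" and k: "homeomorphic_maps (prod_topology (subtopology X (D \<inter> B)) (top_of_set {0..<1})) (subtopology X D) k k'"
    using c by (auto simp: is_collar_def)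
  have DB: "D \<inter> B = B" using B by blast
  have BX: "B \<subseteq> topspace X" using B openin_subset[OF oD] by blast
  let ?Z = "prod_topology (subtopology X B) (top_of_set {0..<1::real})"
  have "{0..<e} = {0..<1} \<inter> {..<e}" using e by auto
  then have "openin (top_of_set {0..<1::real}) {0..<e}" by (metis open_lessThan openin_open_Int)
  then have "openin ?Z (B \<times> {0..<e})"
    using openin_subtopology_refl[of X B] BX by (simp add: openin_prod_Times_iff)
  moreover have "homeomorphic_map ?Z (subtopology X D) k"
    using k unfolding DB homeomorphic_maps_map by blast
  ultimately have "openin (subtopology X D) (k ` (B \<times> {0..<e}))"
    using homeomorphic_map_openness_eq by blast
  then show ?thesis using oD by (simp add: openin_open_subtopology)
qed

text \<open>The levels up to \<open>1/2\<close> at which the collar meets \<open>L\<close> form a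
  compact set of reals, which omits \<open>0\<close> because level \<open>0\<close> is
  \<open>B\<close>. Stopping at \<open>1/2\<close> keeps the levels in a compact part of
  \<open>[0, 1)\<close>.\<close>

lemma collar_avoids:
  assumes c: "is_collar X B D 1 k k'" and B: "B \<subseteq> D" "compactin X B" and L: "closedin X L" "L \<inter> B = {}"
  shows "\<exists>e. 0 < e \<and> e \<le> 1/2 \<and> (\<forall>x \<in> B. \<forall>t. 0 \<le> t \<longrightarrow> t < e \<longrightarrow> k (x, t) \<notin> L)"
proof -
  have oD: "openin X D" and k: "homeomorphic_maps (prod_topology (subtopology X (D \<inter> B)) (top_of_set {0..<1})) (subtopology X D) k k'"
    and k0: "\<And>x. x \<in> D \<inter> B \<Longrightarrow> k (x, 0) = x"
    using c by (auto simp: is_collar_def)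
  have DB: "D \<inter> B = B" using B by blast
  have BX: "B \<subseteq> topspace X" using B openin_subset[OF oD] by blast
  let ?Z = "prod_topology (subtopology X B) (top_of_set {0..<1::real})"
  have ck: "continuous_map ?Z X k"
    using k unfolding DB homeomorphic_maps_def using continuous_map_into_fulltopology by blast
  let ?S = "{z \<in> topspace ?Z. k z \<in> L}"
  have "closedin ?Z ?S" by (rule closedin_continuous_map_preimage[OF ck L(1)])
  moreover have "compactin ?Z (B \<times> {0..1/2})"
    using B(2) by (auto simp: compactin_Times compactin_subtopology)
  ultimately have "compactin ?Z (?S \<inter> B \<times> {0..1/2})"
    using closed_Int_compactin by blast
  moreover have "continuous_map ?Z euclideanreal snd"
    using continuous_map_snd[of "subtopology X B" "top_of_set {0..<1::real}"] by (simp add: continuous_map_in_subtopology)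
  ultimately have "compactin euclideanreal (snd ` (?S \<inter> B \<times> {0..1/2}))"
    by (rule image_compactin)
  then have "closed (snd ` (?S \<inter> B \<times> {0..1/2}))"
    by (simp add: compact_imp_closed)
  moreover have "0 \<notin> snd ` (?S \<inter> B \<times> {0..1/2})"
  proof
    assume "0 \<in> snd ` (?S \<inter> B \<times> {0..1/2})"
    then obtain x where "k (x, 0) \<in> L" "x \<in> B" by auto
    then show False using k0[of x] L(2) DB by auto
  qed
  ultimately have "open (- (snd ` (?S \<inter> B \<times> {0..1/2})))" "0 \<in> - (snd ` (?S \<inter> B \<times> {0..1/2}))"
    by (simp_all only: open_Compl Compl_iff not_False_eq_True)
  then obtain e where e: "e > 0" "ball 0 e \<subseteq> - (snd ` (?S \<inter> B \<times> {0..1/2}))"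
    by (rule openE)
  show ?thesis
  proof (intro exI[of _ "min e (1/2)"] conjI ballI allI impI)
    fix x t assume x: "x \<in> B" and t: "0 \<le> t" "t < min e (1/2)"
    show "k (x, t) \<notin> L"
    proof
      assume "k (x, t) \<in> L"
      then have "t \<in> snd ` (?S \<inter> B \<times> {0..1/2})"
        using x t BX by (intro image_eqI[of _ _ "(x, t)"]) auto
      moreover have "t \<in> ball 0 e" using t by auto
      ultimately show False using e(2) by blast
    qed
  qed (use e in auto)
qed

section \<open>Disjoint sums of two spaces\<close>

lemma compact_space_disjoint_sum_topology:
  assumes "compact_space X" "compact_space Y"
  shows "compact_space (disjoint_sum_topology X Y)"
proof -
  have "{x \<in> topspace X. Inl x \<in> U} = Inl -` U" "{y \<in> topspace Y. Inr y \<in> U} = Inr -` U"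
    if "openin (disjoint_sum_topology X Y) U" for U
    using openin_subset[OF that] by (auto simp: topspace_disjoint_sum_topology)
  then have "continuous_map X (disjoint_sum_topology X Y) Inl" "continuous_map Y (disjoint_sum_topology X Y) Inr"
    by (auto simp: continuous_map_def topspace_disjoint_sum_topology openin_disjoint_sum_topology)
  then have "compactin (disjoint_sum_topology X Y) (Inl ` topspace X \<union> Inr ` topspace Y)"
    using assms unfolding compact_space_def by (intro compactin_Un image_compactin)
  then show ?thesis
    unfolding compact_space_def topspace_disjoint_sum_topology Plus_def by simp
qed

lemma continuous_map_disjoint_sum_topology:
  assumes "continuous_map X Z f" "continuous_map Y Z g"
  shows "continuous_map (disjoint_sum_topology X Y) Z (case_sum f g)"
  unfolding continuous_map_def
proof (intro conjI allI impI)
  show "case_sum f g \<in> topspace (disjoint_sum_topology X Y) \<rightarrow> topspace Z"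
    using assms by (auto simp: topspace_disjoint_sum_topology continuous_map_def)
  fix U assume U: "openin Z U"
  let ?S = "{x \<in> topspace (disjoint_sum_topology X Y). case_sum f g x \<in> U}"
  have "Inl -` ?S = {x \<in> topspace X. f x \<in> U}" "Inr -` ?S = {y \<in> topspace Y. g y \<in> U}"
    by (auto simp: topspace_disjoint_sum_topology)
  then show "openin (disjoint_sum_topology X Y) ?S"
    using assms U by (simp add: openin_disjoint_sum_topology continuous_map_def)
qed

section \<open>The cobordism\<close>

text \<open>The body of \<open>top_h_cobordant\<close> for points of any type: the cobordism is
  built inside \<open>C1\<close> and moved to the type \<open>nat => real\<close> only at the end.
  Here \<open>n\<close> is the dimension of \<open>W\<close>, not of its ends.\<close>

definition cobordism :: "nat \<Rightarrow> 'a topology \<Rightarrow> 'b topology \<Rightarrow> 'c topology \<Rightarrow> ('a + 'b \<Rightarrow> 'c) \<Rightarrow> bool"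
  where "cobordism n Y0 Y1 W h \<longleftrightarrow> top_manifold n W \<and> compact_space W \<and>
       homeomorphic_map (disjoint_sum_topology Y0 Y1) (subtopology W (manifold_boundary n W)) h \<and>
       homotopy_equivalence_map Y0 W (h \<circ> Inl) \<and> homotopy_equivalence_map Y1 W (h \<circ> Inr)"

lemma has_chart_open_subspace_iff:
  assumes "openin X S" "S \<subseteq> A" "x \<in> S"
  shows "has_chart E (subtopology X A) x \<longleftrightarrow> has_chart E X x"
proof -
  have e: "subtopology (subtopology X A) S = subtopology X S"
    using assms(2) by (simp add: subtopology_subtopology inf_absorb2)
  have o: "openin (subtopology X A) S"
    unfolding openin_subtopology using assms(1,2) by blast
  show ?thesis
    using has_chart_subtopology_iff[OF o assms(3)] has_chart_subtopology_iff[OF assms(1,3)] unfolding e by metis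
qed

lemma cobordism_of_interiors:
  fixes C0 :: "'a topology" and C1 :: "'b topology"
  assumes n: "n \<ge> 1"
    and C0: "top_manifold n C0" "compact_space C0"
    and C1: "top_manifold n C1" "compact_space C1"
    and hom: "homeomorphic_maps (subtopology C0 (manifold_interior n C0))
         (subtopology C1 (manifold_interior n C1)) \<phi> \<psi>"
  shows "\<exists>W h. cobordism n (subtopology C0 (manifold_boundary n C0))
           (subtopology C1 (manifold_boundary n C1)) (subtopology C1 W) h"
proof -
  define B0 where "B0 = manifold_boundary n C0"
  define B1 where "B1 = manifold_boundary n C1"
  define I0 where "I0 = manifold_interior n C0"
  define I1 where "I1 = manifold_interior n C1"
  obtain D0 c0 c0' where D0: "B0 \<subseteq> D0" and c0: "is_collar C0 B0 D0 1 c0 c0'"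
    using manifold_collar[OF n C0] unfolding B0_def by blast
  obtain D1 c1 c1' where D1: "B1 \<subseteq> D1" and c1: "is_collar C1 B1 D1 1 c1 c1'"
    using manifold_collar[OF n C1] unfolding B1_def by blast
  have H0: "Hausdorff_space C0" and H1: "Hausdorff_space C1" and S1: "second_countable C1"
    using C0 C1 by (auto simp: top_manifold_def)
  have oI0: "openin C0 I0" and oI1: "openin C1 I1" unfolding I0_def I1_def by (rule openin_manifold_interior)+
  have B0I0: "B0 = topspace C0 - I0" and B1I1: "B1 = topspace C1 - I1"
    by (simp_all add: B0_def I0_def B1_def I1_def manifold_boundary_def)
  have I0: "I0 = topspace C0 - B0" and I1: "I1 = topspace C1 - B1"
    using B0I0 B1I1 openin_subset[OF oI0] openin_subset[OF oI1] by blast+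
  have clB: "closedin C0 B0" "closedin C1 B1" unfolding B0_def B1_def by (rule closedin_manifold_boundary)+
  have B0C: "B0 \<subseteq> topspace C0" and B1C: "B1 \<subseteq> topspace C1" using clB closedin_subset by blast+
  have cB: "compactin C0 B0" "compactin C1 B1" using clB C0 C1 closedin_compact_space by blast+
  have hom: "homeomorphic_maps (subtopology C0 I0) (subtopology C1 I1) \<phi> \<psi>"
    using hom unfolding I0_def I1_def .
  have topI: "topspace (subtopology C0 I0) = I0" "topspace (subtopology C1 I1) = I1"
    using I0 I1 by auto
  have c\<phi>: "continuous_map (subtopology C0 I0) (subtopology C1 I1) \<phi>"
    and c\<psi>: "continuous_map (subtopology C1 I1) (subtopology C0 I0) \<psi>"
    and \<psi>\<phi>: "\<And>x. x \<in> I0 \<Longrightarrow> \<psi> (\<phi> x) = x" and \<phi>\<psi>: "\<And>y. y \<in> I1 \<Longrightarrow> \<phi> (\<psi> y) = y"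
    using hom unfolding homeomorphic_maps_def topI by blast+
  have \<phi>I: "\<phi> x \<in> I1" if "x \<in> I0" for x
    using continuous_map_image_subset_topspace[OF c\<phi>] that unfolding topI by blast
  have \<psi>I: "\<psi> y \<in> I0" if "y \<in> I1" for y
    using continuous_map_image_subset_topspace[OF c\<psi>] that unfolding topI by blast
  have c0_0: "c0 (x, 0) = x" if "x \<in> B0" for x using c0 that D0 by (auto simp: is_collar_def)
  have c1_0: "c1 (x, 0) = x" if "x \<in> B1" for x using c1 that D1 by (auto simp: is_collar_def)
  note r0 = collar_restrict[OF c0 D0] note r1 = collar_restrict[OF c1 D1]
  note ro0 = collar_restrict_open[OF c0 D0] note ro1 = collar_restrict_open[OF c1 D1]
  have top0: "topspace (prod_topology (subtopology C0 B0) (top_of_set J)) = B0 \<times> J" for J :: "real set"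
    using B0C by auto
  have top1: "topspace (prod_topology (subtopology C1 B1) (top_of_set J)) = B1 \<times> J" for J :: "real set"
    using B1C by auto
  have c0c: "continuous_map (prod_topology (subtopology C0 B0) (top_of_set {0..<1})) C0 c0"
    using r0[of "{0..<1}"] unfolding homeomorphic_maps_def using continuous_map_into_fulltopology by blast
  have c1c: "continuous_map (prod_topology (subtopology C1 B1) (top_of_set {0..<1})) C1 c1"
    using r1[of "{0..<1}"] unfolding homeomorphic_maps_def using continuous_map_into_fulltopology by blast
  have c0C: "c0 (x, t) \<in> topspace C0" if "x \<in> B0" "0 \<le> t" "t < 1" for x t
    using continuous_map_image_subset_topspace[OF c0c] that unfolding top0 by auto
  have c1C: "c1 (x, t) \<in> topspace C1" if "x \<in> B1" "0 \<le> t" "t < 1" for x t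
    using continuous_map_image_subset_topspace[OF c1c] that unfolding top1 by auto
  have c0c0: "c0' (c0 (x, t)) = (x, t)" if "x \<in> B0" "0 \<le> t" "t < 1" for x t
    using r0[of "{0..<1}"] that unfolding homeomorphic_maps_def top0 by auto
  have c1c1: "c1' (c1 (x, t)) = (x, t)" if "x \<in> B1" "0 \<le> t" "t < 1" for x t
    using r1[of "{0..<1}"] that unfolding homeomorphic_maps_def top1 by auto
  \<comment> \<open>A point \<open>y\<close> of \<open>B0\<close> is \<open>c0 (y, 0)\<close>, so
    injectivity of \<open>c0\<close> forces \<open>t = 0\<close>.\<close>
  have c0B: "c0 (x, t) \<in> B0 \<longleftrightarrow> t = 0" if "x \<in> B0" "0 \<le> t" "t < 1" for x t
    using c0c0[OF that] c0c0[of "c0 (x, t)" 0] c0_0 that by fastforce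
  have c1B: "c1 (x, t) \<in> B1 \<longleftrightarrow> t = 0" if "x \<in> B1" "0 \<le> t" "t < 1" for x t
    using c1c1[OF that] c1c1[of "c1 (x, t)" 0] c1_0 that by fastforce

  \<comment> \<open>\<open>E0\<close> is open and \<open>F0\<close> compact, so \<open>K\<close> is
    compact and \<open>K'\<close> open; they differ exactly in level \<open>1/2\<close>. Removing
    the image of \<open>K'\<close> leaves that level in \<open>W\<close> as the second end, while
    the image of \<open>K\<close> is what the collar of \<open>B1\<close> has to avoid.\<close>
  define E0 where "E0 = c0 ` (B0 \<times> {0..<1/2})"
  define F0 where "F0 = c0 ` (B0 \<times> {0..1/2})"
  define G0 where "G0 = c0 ` (B0 \<times> {0<..1/2})"
  define K where "K = topspace C0 - E0"
  define K' where "K' = topspace C0 - F0"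
  have oE0: "openin C0 E0" unfolding E0_def by (rule ro0) simp
  have BE0: "B0 \<subseteq> E0" using c0_0 unfolding E0_def by force
  have BF0: "E0 \<subseteq> F0" unfolding E0_def F0_def by fastforce
  have "compactin C0 F0"
    unfolding F0_def
    by (rule image_compactin[OF _ c0c]) (use cB in \<open>auto simp: compactin_Times compactin_subtopology\<close>)
  then have clF0: "closedin C0 F0" using H0 compactin_imp_closedin by blast
  have K: "K \<subseteq> I0" "K' \<subseteq> K" using BE0 BF0 I0 by (auto simp: K_def K'_def)
  have "closedin C0 K" unfolding K_def using oE0 by blast
  then have "compactin C0 K" using C0(2) closedin_compact_space by blast
  then have "compactin (subtopology C0 I0) K" using K by (simp add: compactin_subtopology)
  from image_compactin[OF this c\<phi>] have "compactin C1 (\<phi> ` K)" by (simp add: compactin_subtopology)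
  then have cl\<phi>K: "closedin C1 (\<phi> ` K)" using H1 compactin_imp_closedin by blast
  have hm: "homeomorphic_map (subtopology C0 I0) (subtopology C1 I1) \<phi>"
    using hom homeomorphic_maps_map by blast
  have "openin C0 K'" unfolding K'_def using clF0 by blast
  then have o\<phi>K': "openin C1 (\<phi> ` K')"
    using homeomorphic_map_restrict_open(1)[OF hm oI0 oI1] K by blast
  define W where "W = topspace C1 - \<phi> ` K'"
  define X where "X = subtopology C1 W"
  have clW: "closedin C1 W" unfolding W_def using o\<phi>K' by blast
  have topX: "topspace X = W" unfolding X_def using closedin_subset[OF clW] by auto
  have compX: "compact_space X"
    unfolding X_def using clW C1(2) by (metis closedin_compact_space compact_space_subtopology)
  have HX: "Hausdorff_space X" unfolding X_def using H1 Hausdorff_space_subtopology by blast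
  have SX: "second_countable X" unfolding X_def using S1 second_countable_subtopology by blast
  have \<phi>KI: "\<phi> ` K \<subseteq> I1" using \<phi>I K by blast
  have B1W: "B1 \<subseteq> W" using \<phi>KI K B1I1 by (auto simp: W_def)
  have G0: "G0 = I0 - K'"
  proof -
    have "I0 - K' = F0 - B0" using I0 closedin_subset[OF clF0] by (auto simp: K'_def)
    also have "\<dots> = G0"
      using c0B by (force simp: F0_def G0_def)
    finally show ?thesis by simp
  qed
  have WB: "W - B1 = \<phi> ` G0"
  proof
    show "\<phi> ` G0 \<subseteq> W - B1"
    proof
      fix w assume "w \<in> \<phi> ` G0"
      then obtain x where x: "x \<in> I0" "x \<notin> K'" "w = \<phi> x" unfolding G0 by blast
      have "w \<notin> \<phi> ` K'" using x K \<psi>\<phi> by (metis imageE subsetD)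
      then show "w \<in> W - B1" using \<phi>I[OF x(1)] x(3) I1 by (auto simp: W_def)
    qed
    show "W - B1 \<subseteq> \<phi> ` G0"
    proof
      fix w assume "w \<in> W - B1"
      then have w: "w \<in> I1" "w \<notin> \<phi> ` K'" using I1 by (auto simp: W_def)
      have "\<psi> w \<in> G0" unfolding G0 using \<psi>I[OF w(1)] \<phi>\<psi>[OF w(1)] w(2) by force
      then show "w \<in> \<phi> ` G0" using \<phi>\<psi>[OF w(1)] by (metis imageI)
    qed
  qed
  have oWB: "openin X (W - B1)"
  proof -
    have "closedin X B1" unfolding X_def by (rule closedin_subset_topspace[OF clB(2) B1W])
    then show ?thesis using openin_diff[OF openin_topspace] unfolding topX[symmetric] by blast
  qed
  \<comment> \<open>Coordinates on \<open>W - B1\<close>: the new end is level \<open>1/2\<close>,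
    and levels tending to \<open>0\<close> approach \<open>B1\<close>.\<close>
  define m0 where "m0 = \<phi> \<circ> c0"
  define m0' where "m0' = c0' \<circ> \<psi>"
  let ?Z0 = "\<lambda>J. prod_topology (subtopology C0 B0) (top_of_set (J :: real set))"
  let ?Z1 = "\<lambda>J. prod_topology (subtopology C1 B1) (top_of_set (J :: real set))"
  have m0: "homeomorphic_maps (?Z0 {0<..1/2}) (subtopology X (W - B1)) m0 m0'"
  proof -
    have 1: "homeomorphic_maps (?Z0 {0<..1/2}) (subtopology C0 G0) c0 c0'"
      unfolding G0_def by (rule r0) auto
    have 2: "homeomorphic_maps (subtopology C0 G0) (subtopology C1 (\<phi> ` G0)) \<phi> \<psi>"
      by (rule homeomorphic_maps_restrict[OF hom]) (use G0 I0 in auto)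
    have "subtopology X (W - B1) = subtopology C1 (\<phi> ` G0)"
      unfolding X_def subtopology_subtopology WB[symmetric] by (simp add: inf_absorb2)
    then show ?thesis
      using homeomorphic_maps_compose[OF conjI[OF 1 2]] by (simp add: m0_def m0'_def)
  qed
  have m0W: "m0 (x, t) \<in> W - B1" if "x \<in> B0" "0 < t" "t \<le> 1/2" for x t
    unfolding WB using that by (auto simp: m0_def G0_def)
  have m0m0: "m0' (m0 (x, t)) = (x, t)" if "x \<in> B0" "0 < t" "t \<le> 1/2" for x t
    using m0 that unfolding homeomorphic_maps_def top0 by auto

  \<comment> \<open>The collar of \<open>B1\<close> is cut so short that it lies in \<open>W\<close>
    and misses the new end.\<close>
  obtain e where e: "0 < e" "e \<le> 1/2" and eK: "\<And>x t. x \<in> B1 \<Longrightarrow> 0 \<le> t \<Longrightarrow> t < e \<Longrightarrow> c1 (x, t) \<notin> \<phi> ` K"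
    using collar_avoids[OF c1 D1 cB(2) cl\<phi>K] \<phi>KI B1I1 by blast
  define E1 where "E1 = c1 ` (B1 \<times> {0..<e})"
  have oE1: "openin C1 E1" unfolding E1_def using ro1 e by simp
  have E1K: "E1 \<inter> \<phi> ` K = {}" using eK unfolding E1_def by fastforce
  have E1W: "E1 \<subseteq> W" using E1K K openin_subset[OF oE1] by (auto simp: W_def)
  have BE1: "B1 \<subseteq> E1" using c1_0 e unfolding E1_def by force
  have sub1: "subtopology X E1 = subtopology C1 E1"
    unfolding X_def subtopology_subtopology using E1W by (simp add: inf_absorb2)
  have oXE1: "openin X E1"
    unfolding X_def openin_subtopology using oE1 E1W by blast
  have h1: "homeomorphic_maps (?Z1 {0..<e}) (subtopology X E1) c1 c1'"
    unfolding sub1 unfolding E1_def by (rule r1) (use e in auto)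

  \<comment> \<open>The same compactness argument with the roles exchanged: what lies outside
    \<open>E1\<close> is compact in the interior, so its image under \<open>\<psi>\<close> misses a
    short collar of \<open>B0\<close>.\<close>
  have "closedin C1 (topspace C1 - E1)" using oE1 by blast
  then have "compactin C1 (topspace C1 - E1)" using C1(2) closedin_compact_space by blast
  then have "compactin (subtopology C1 I1) (topspace C1 - E1)" using BE1 I1 by (auto simp: compactin_subtopology)
  from image_compactin[OF this c\<psi>] have "compactin C0 (\<psi> ` (topspace C1 - E1))" by (simp add: compactin_subtopology)
  then have cl\<psi>: "closedin C0 (\<psi> ` (topspace C1 - E1))" using H0 compactin_imp_closedin by blast
  have "\<psi> ` (topspace C1 - E1) \<inter> B0 = {}"
    using \<psi>I BE1 I1 B0I0 by blast
  from collar_avoids[OF c0 D0 cB(1) cl\<psi> this] obtain d' where d': "0 < d'" "d' \<le> 1/2"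
    "\<And>x t. x \<in> B0 \<Longrightarrow> 0 \<le> t \<Longrightarrow> t < d' \<Longrightarrow> c0 (x, t) \<notin> \<psi> ` (topspace C1 - E1)"
    by blast
  \<comment> \<open>\<open>d'\<close> bounds levels strictly, whereas the slide attains level
    \<open>d\<close>; halving makes \<open>t <= d\<close> admissible and gives
    \<open>d < 1/2\<close>.\<close>
  define d where "d = d' / 2"
  have d: "0 < d" "d < 1/2" using d' by (auto simp: d_def)
  have c0I: "c0 (x, t) \<in> I0" if "x \<in> B0" "0 < t" "t \<le> 1/2" for x t
    using c0C[of x t] c0B[of x t] that I0 by auto
  have m0E1: "m0 (x, t) \<in> E1" if x: "x \<in> B0" "0 < t" "t \<le> d" for x t
  proof (rule ccontr)
    assume "m0 (x, t) \<notin> E1"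
    moreover have "c0 (x, t) \<in> I0" using c0I x d by simp
    ultimately have "\<psi> (m0 (x, t)) \<in> \<psi> ` (topspace C1 - E1)"
      using \<phi>I I1 by (auto simp: m0_def)
    then show False using d'(3)[of x t] x \<psi>\<phi> \<open>c0 (x, t) \<in> I0\<close> d' by (simp add: m0_def d_def)
  qed

  \<comment> \<open>Lowering levels to at most \<open>d\<close> brings \<open>W - B1\<close> into
    \<open>E1\<close> and moves only levels in the compact \<open>[d, 1/2]\<close>. The condition
    that the end stays fixed is vacuous here, since \<open>B1\<close> is disjoint from
    \<open>W - B1\<close>.\<close>
  have eq1: "homotopy_equivalence_map (subtopology C1 B1) X (\<lambda>y. c1 (y, 0))"
  proof (rule homotopy_equivalence_map_slide[OF HX oWB m0, where T = "{d..1/2}" and g = "\<lambda>t. min t d" and J' = "{0..<e}" and E = E1 and m' = c1'])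
    show "convex {0<..1/2::real}" by (rule convex_real_interval)
    show "compactin (subtopology C0 B0) (topspace (subtopology C0 B0))"
      using cB B0C by (simp add: compactin_subtopology inf_absorb2)
    show "compact {d..1/2}" "{d..1/2} \<subseteq> {0<..1/2}" using d by auto
    show "continuous_on {0<..1/2} (\<lambda>t. min t d)" by (intro continuous_intros)
    show "(\<lambda>t. min t d) ` {0<..1/2} \<subseteq> {0<..1/2}" using d by auto
    show "min t d = t" if "t \<in> {0<..1/2} - {d..1/2}" for t using that by auto
    show "homeomorphic_maps (?Z1 {0..<e}) (subtopology X E1) c1 c1'" by (rule h1)
    show "convex {0..<e}" by (rule convex_real_interval)
    show "0 \<in> {0..<e}" using e by simp
    show "w \<in> E1" if "w \<in> topspace X - (W - B1)" for w using that BE1 unfolding topX by blast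
    show "m0 (y, min t d) \<in> E1" if "y \<in> topspace (subtopology C0 B0)" "t \<in> {0<..1/2}" for y t
      using m0E1[of y "min t d"] that d by auto
    show "min (snd (m0' (c1 (y, 0)))) d = snd (m0' (c1 (y, 0)))"
      if "y \<in> topspace (subtopology C1 B1)" "c1 (y, 0) \<in> W - B1" for y
      using that c1_0 by auto
  qed

  have m0K: "m0 (x, 1/2) \<in> \<phi> ` K" if "x \<in> B0" for x
  proof -
    have "c0 (x, 1/2) \<notin> E0"
    proof
      assume "c0 (x, 1/2) \<in> E0"
      then obtain y t where y: "y \<in> B0" "0 \<le> t" "t < 1/2" "c0 (x, 1/2) = c0 (y, t)" by (auto simp: E0_def)
      then have "(x, 1/2) = (y, t)" using c0c0[of x "1/2"] c0c0[of y t] that by simp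
      then show False using y by simp
    qed
    then show ?thesis using c0C[of x "1/2"] that by (auto simp: m0_def K_def)
  qed
  \<comment> \<open>Dually, raising levels in \<open>E1\<close> to at least \<open>e/2\<close>
    clears \<open>B1\<close>. The end at level \<open>1/2\<close> is untouched because it lies in
    the image of \<open>K\<close>, which \<open>E1\<close> misses.\<close>
  have eq0: "homotopy_equivalence_map (subtopology C0 B0) X (\<lambda>x. m0 (x, 1/2))"
  proof (rule homotopy_equivalence_map_slide[OF HX oXE1 h1, where T = "{0..e/2}" and g = "\<lambda>t. max t (e/2)" and J' = "{0<..1/2}" and E = "W - B1" and m' = m0'])
    show "convex {0..<e}" by (rule convex_real_interval)
    show "compactin (subtopology C1 B1) (topspace (subtopology C1 B1))"
      using cB B1C by (simp add: compactin_subtopology inf_absorb2)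
    show "compact {0..e/2}" "{0..e/2} \<subseteq> {0..<e}" using e by auto
    show "continuous_on {0..<e} (\<lambda>t. max t (e/2))" by (intro continuous_intros)
    show "(\<lambda>t. max t (e/2)) ` {0..<e} \<subseteq> {0..<e}" using e by auto
    show "max t (e/2) = t" if "t \<in> {0..<e} - {0..e/2}" for t using that by auto
    show "homeomorphic_maps (?Z0 {0<..1/2}) (subtopology X (W - B1)) m0 m0'" by (rule m0)
    show "convex {0<..1/2::real}" by (rule convex_real_interval)
    show "1/2 \<in> {0<..1/2::real}" by simp
    show "w \<in> W - B1" if "w \<in> topspace X - E1" for w using that BE1 unfolding topX by blast
    show "c1 (y, max t (e/2)) \<in> W - B1" if "y \<in> topspace (subtopology C1 B1)" "t \<in> {0..<e}" for y t
    proof -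
      have y: "y \<in> B1" and t: "0 \<le> max t (e/2)" "max t (e/2) < e" "max t (e/2) \<noteq> 0" using that e by auto
      then have "c1 (y, max t (e/2)) \<in> E1" by (auto simp: E1_def)
      moreover have "c1 (y, max t (e/2)) \<notin> B1" using c1B[of y "max t (e/2)"] y t e by auto
      ultimately show ?thesis using E1W by blast
    qed
    show "max (snd (c1' (m0 (y, 1/2)))) (e/2) = snd (c1' (m0 (y, 1/2)))"
      if "y \<in> topspace (subtopology C0 B0)" "m0 (y, 1/2) \<in> E1" for y
      using that m0K E1K by auto
  qed

  \<comment> \<open>\<open>W1\<close> is open in \<open>C1\<close> and contained in
    \<open>W\<close>, so at its points \<open>W\<close> has the charts of \<open>C1\<close>. It
    contains \<open>B1\<close>; the remaining points of \<open>W\<close> are reached through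
    \<open>m0\<close>.\<close>
  define W1 where "W1 = topspace C1 - \<phi> ` K"
  have oW1: "openin C1 W1" unfolding W1_def using cl\<phi>K by blast
  have W1W: "W1 \<subseteq> W" using K by (auto simp: W1_def W_def)
  have chart1: "has_chart E X w \<longleftrightarrow> has_chart E C1 w" if "w \<in> W1" for w and E :: "(nat \<Rightarrow> real) topology"
    unfolding X_def by (rule has_chart_open_subspace_iff[OF oW1 W1W that])
  have B1W1: "B1 \<subseteq> W1" using \<phi>KI B1I1 by (auto simp: W1_def)
  \<comment> \<open>The reflection of levels identifies the open collar \<open>E0\<close> of
    \<open>C0\<close> with \<open>W - B1\<close> and takes \<open>B0\<close> to the new end, so both
    the charts and the distinction between interior and boundary come from
    \<open>C0\<close>.\<close>
  define q where "q = m0 \<circ> (\<lambda>z. (fst z, 1/2 - snd z)) \<circ> c0'"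
  have q: "homeomorphic_map (subtopology C0 E0) (subtopology X (W - B1)) q"
  proof -
    have 1: "homeomorphic_map (subtopology C0 E0) (?Z0 {0..<1/2}) c0'"
      using r0[of "{0..<1/2}"] unfolding E0_def homeomorphic_maps_map by auto
    have f: "continuous_map (?Z0 J) (?Z0 J') (\<lambda>z. (fst z, 1/2 - snd z))"
      if "\<And>t. t \<in> J \<Longrightarrow> 1/2 - t \<in> J'" for J J'
    proof -
      have "continuous_map (?Z0 J) euclideanreal snd"
        using continuous_map_snd[of "subtopology C0 B0" "top_of_set J"] by (simp add: continuous_map_in_subtopology)
      then show ?thesis
        using that
        by (intro continuous_map_pairedI continuous_map_fst continuous_map_into_subtopology continuous_intros) auto
    qed
    have "homeomorphic_maps (?Z0 {0..<1/2}) (?Z0 {0<..1/2}) (\<lambda>z. (fst z, 1/2 - snd z)) (\<lambda>z. (fst z, 1/2 - snd z))"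
      unfolding homeomorphic_maps_def by (intro conjI f ballI) auto
    then have 2: "homeomorphic_map (?Z0 {0..<1/2}) (?Z0 {0<..1/2}) (\<lambda>z. (fst z, 1/2 - snd z))"
      using homeomorphic_maps_map by blast
    have 3: "homeomorphic_map (?Z0 {0<..1/2}) (subtopology X (W - B1)) m0"
      using m0 homeomorphic_maps_map by blast
    show ?thesis
      unfolding q_def using homeomorphic_map_compose[OF 1 homeomorphic_map_compose[OF 2 3]] by (simp add: comp_assoc)
  qed
  have chart0: "has_chart E X (m0 (x, t)) \<longleftrightarrow> has_chart E C0 (c0 (x, 1/2 - t))"
    if x: "x \<in> B0" "0 < t" "t \<le> 1/2" for x t and E :: "(nat \<Rightarrow> real) topology"
  proof -
    have "q (c0 (x, 1/2 - t)) = m0 (x, t)"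
      using c0c0[of x "1/2 - t"] x by (simp add: q_def)
    moreover have "c0 (x, 1/2 - t) \<in> E0" using x by (auto simp: E0_def)
    ultimately show ?thesis
      using has_chart_transfer_iff[OF q oE0 oWB, of "c0 (x, 1/2 - t)" E] by simp
  qed
  have Wcases: "w \<in> W1 \<or> (\<exists>x t. x \<in> B0 \<and> 0 < t \<and> t \<le> 1/2 \<and> w = m0 (x, t))" if "w \<in> W" for w
  proof (cases "w \<in> B1")
    case False
    then have "w \<in> \<phi> ` G0" using that WB by blast
    then obtain x t where "x \<in> B0" "t \<in> {0<..1/2}" "w = \<phi> (c0 (x, t))"
      unfolding G0_def by blast
    then have "x \<in> B0 \<and> 0 < t \<and> t \<le> 1/2 \<and> w = m0 (x, t)" by (simp add: m0_def)
    then show ?thesis by blast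
  qed (use B1W1 in blast)
  have manX: "top_manifold n X"
    unfolding top_manifold_iff topX
  proof (intro conjI HX SX ballI)
    fix w assume "w \<in> W"
    from Wcases[OF this] show "has_chart (half_space n) X w"
    proof
      assume "w \<in> W1"
      then show ?thesis using chart1 C1(1) openin_subset[OF oW1] unfolding top_manifold_iff by blast
    next
      assume "\<exists>x t. x \<in> B0 \<and> 0 < t \<and> t \<le> 1/2 \<and> w = m0 (x, t)"
      then obtain x t where "x \<in> B0" "0 < t" "t \<le> 1/2" "w = m0 (x, t)" by blast
      then show ?thesis using chart0[of x t] c0C[of x "1/2 - t"] C0(1) unfolding top_manifold_iff by auto
    qed
  qed
  have int0: "has_chart (Euclidean_space n) C0 x \<longleftrightarrow> x \<notin> B0" if "x \<in> topspace C0" for x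
    using that by (auto simp: B0_def manifold_boundary_def manifold_interior_iff)
  have int1: "has_chart (Euclidean_space n) C1 x \<longleftrightarrow> x \<notin> B1" if "x \<in> topspace C1" for x
    using that by (auto simp: B1_def manifold_boundary_def manifold_interior_iff)
  have bd: "manifold_boundary n X = (\<lambda>x. m0 (x, 1/2)) ` B0 \<union> B1"
  proof (intro Set.set_eqI iffI)
    fix w assume w: "w \<in> manifold_boundary n X"
    then have wW: "w \<in> W" and nc: "\<not> has_chart (Euclidean_space n) X w"
      by (auto simp: manifold_boundary_def manifold_interior_iff topX)
    from Wcases[OF wW] show "w \<in> (\<lambda>x. m0 (x, 1/2)) ` B0 \<union> B1"
    proof
      assume "w \<in> W1"
      then show ?thesis using chart1 nc int1 openin_subset[OF oW1] by blast
    next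
      assume "\<exists>x t. x \<in> B0 \<and> 0 < t \<and> t \<le> 1/2 \<and> w = m0 (x, t)"
      then obtain x t where x: "x \<in> B0" "0 < t" "t \<le> 1/2" "w = m0 (x, t)" by blast
      then have "c0 (x, 1/2 - t) \<in> B0" using chart0[of x t] nc int0 c0C[of x "1/2 - t"] by auto
      then have "t = 1/2" using c0B[of x "1/2 - t"] x by auto
      then show ?thesis using x by blast
    qed
  next
    fix w assume "w \<in> (\<lambda>x. m0 (x, 1/2)) ` B0 \<union> B1"
    then show "w \<in> manifold_boundary n X"
    proof
      assume "w \<in> B1"
      then show ?thesis using chart1[of w] int1[of w] B1W1 B1W B1C
        by (auto simp: manifold_boundary_def manifold_interior_iff topX)
    next
      assume "w \<in> (\<lambda>x. m0 (x, 1/2)) ` B0"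
      then obtain x where x: "x \<in> B0" "w = m0 (x, 1/2)" by blast
      then have "\<not> has_chart (Euclidean_space n) X w"
        using chart0[of x "1/2"] c0_0[of x] int0[of x] B0C by auto
      then show ?thesis using m0W[of x "1/2"] x
        by (auto simp: manifold_boundary_def manifold_interior_iff topX)
    qed
  qed
  define h where "h = case_sum (\<lambda>x. m0 (x, 1/2)) (\<lambda>y. c1 (y, 0))"
  have hl: "h \<circ> Inl = (\<lambda>x. m0 (x, 1/2))" and hr: "h \<circ> Inr = (\<lambda>y. c1 (y, 0))"
    by (auto simp: h_def)
  let ?D = "disjoint_sum_topology (subtopology C0 B0) (subtopology C1 B1)"
  have topD: "topspace ?D = B0 <+> B1"
    using B0C B1C by (simp add: topspace_disjoint_sum_topology inf_absorb2)
  have him: "h ` (B0 <+> B1) = (\<lambda>x. m0 (x, 1/2)) ` B0 \<union> B1"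
    using c1_0 by (force simp: h_def image_iff Plus_def)
  have "homeomorphic_map ?D (subtopology X (manifold_boundary n X)) h"
  \<comment> \<open>A continuous bijection from a compact space onto a Hausdorff space; only
    injectivity needs work.\<close>
  proof (rule continuous_imp_homeomorphic_map)
    have "continuous_map ?D X h"
      unfolding h_def using eq0 eq1
      by (intro continuous_map_disjoint_sum_topology) (auto simp: homotopy_equivalence_map_def)
    then show "continuous_map ?D (subtopology X (manifold_boundary n X)) h"
      using him unfolding bd by (intro continuous_map_into_subtopology) (auto simp: topD)
    show "compact_space ?D"
      using cB by (intro compact_space_disjoint_sum_topology) (auto simp: compact_space_subtopology)
    show "Hausdorff_space (subtopology X (manifold_boundary n X))"
      using HX Hausdorff_space_subtopology by blast
    have "manifold_boundary n X \<subseteq> topspace X" by (auto simp: manifold_boundary_def)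
    then show "h ` topspace ?D = topspace (subtopology X (manifold_boundary n X))"
      unfolding topD him topspace_subtopology bd by (rule inf_absorb2[symmetric])
    have a: "x = y" if "x \<in> B0" "y \<in> B0" "m0 (x, 1/2) = m0 (y, 1/2)" for x y
    proof -
      have "m0' (m0 (x, 1/2)) = (x, 1/2)" "m0' (m0 (y, 1/2)) = (y, 1/2)"
        by (rule m0m0; use that in simp)+
      then show ?thesis using that(3) by (metis prod.inject)
    qed
    have b: "m0 (x, 1/2) \<noteq> y" if "x \<in> B0" "y \<in> B1" for x y
    proof -
      have "m0 (x, 1/2) \<in> W - B1" by (rule m0W; use that in simp)
      then show ?thesis using that(2) by (metis DiffD2)
    qed
    show "inj_on h (topspace ?D)"
      unfolding topD
    proof (rule inj_onI)
      fix u v assume uv: "u \<in> B0 <+> B1" "v \<in> B0 <+> B1" "h u = h v"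
      have hI: "h (Inl x) = m0 (x, 1/2)" for x by (simp add: h_def)
      have hJ: "h (Inr y) = y" if "y \<in> B1" for y using c1_0[OF that] by (simp add: h_def)
      show "u = v"
      proof (cases u)
        case (Inl x)
        then have x: "x \<in> B0" using uv by auto
        show ?thesis
        proof (cases v)
          case (Inl x')
          then show ?thesis using a[of x x'] x uv hI \<open>u = Inl x\<close> by auto
        next
          case (Inr y)
          then have "y \<in> B1" using uv by auto
          then show ?thesis using b[OF x, of y] hI[of x] hJ[of y] uv Inr \<open>u = Inl x\<close> by simp
        qed
      next
        case (Inr y)
        then have y: "y \<in> B1" using uv by auto
        show ?thesis
        proof (cases v)
          case (Inl x)
          then have "x \<in> B0" using uv by auto
          then show ?thesis using b[OF _ y, of x] hI[of x] hJ[OF y] uv Inl \<open>u = Inr y\<close> by simp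
        next
          case (Inr y')
          then have "y' \<in> B1" using uv by auto
          then show ?thesis using hJ[OF y] hJ[of y'] uv Inr \<open>u = Inr y\<close> by simp
        qed
      qed
    qed
  qed
  then have "cobordism n (subtopology C0 B0) (subtopology C1 B1) X h"
    unfolding cobordism_def hl hr using manX compX eq0 eq1 by blast
  then show ?thesis unfolding X_def B0_def B1_def by blast
qed

section \<open>Transport of cobordisms along homeomorphisms\<close>

lemma homotopy_equivalence_map_compose_homeomorphic:
  assumes e: "homotopy_equivalence_map Y W e" and f: "homeomorphic_maps W W' f g"
  shows "homotopy_equivalence_map Y W' (f \<circ> e)"
proof -
  obtain r where ce: "continuous_map Y W e" and cr: "continuous_map W Y r"
    and re: "homotopic_with (\<lambda>_. True) Y Y (r \<circ> e) id" and er: "homotopic_with (\<lambda>_. True) W W (e \<circ> r) id"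
    using e unfolding homotopy_equivalence_map_def by blast
  have cf: "continuous_map W W' f" and cg: "continuous_map W' W g"
    and gf: "\<And>w. w \<in> topspace W \<Longrightarrow> g (f w) = w" and fg: "\<And>w. w \<in> topspace W' \<Longrightarrow> f (g w) = w"
    using f unfolding homeomorphic_maps_def by blast+
  have eW: "e y \<in> topspace W" if "y \<in> topspace Y" for y
    using continuous_map_image_subset_topspace[OF ce] that by blast
  have "homotopic_with (\<lambda>_. True) Y Y ((r \<circ> g) \<circ> (f \<circ> e)) id"
    by (rule homotopic_with_eq[OF re]) (use gf eW in auto)
  moreover have "homotopic_with (\<lambda>_. True) W' W' (f \<circ> (e \<circ> r) \<circ> g) (f \<circ> id \<circ> g)"
    by (intro homotopic_with_compose_continuous_map_right[OF _ cg, where p = "\<lambda>_. True"]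
        homotopic_with_compose_continuous_map_left[OF er cf]) auto
  then have "homotopic_with (\<lambda>_. True) W' W' ((f \<circ> e) \<circ> (r \<circ> g)) id"
    by (rule homotopic_with_eq) (use fg in auto)
  ultimately show ?thesis
    unfolding homotopy_equivalence_map_def
    using continuous_map_compose[OF ce cf] continuous_map_compose[OF cg cr] by blast
qed

lemma manifold_boundary_eq: "manifold_boundary n X = {x \<in> topspace X. \<not> has_chart (Euclidean_space n) X x}"
  by (auto simp: manifold_boundary_def manifold_interior_iff)

lemma homeomorphic_map_manifold_boundary:
  assumes f: "homeomorphic_map W W' f"
  shows "f ` manifold_boundary n W = manifold_boundary n W'"
proof -
  have "has_chart (Euclidean_space n) W' (f x) \<longleftrightarrow> has_chart (Euclidean_space n) W x" if "x \<in> topspace W" for x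
    using has_chart_transfer_iff[of W "topspace W" W' "topspace W'" f x] f that by simp
  then show ?thesis
    unfolding manifold_boundary_eq homeomorphic_imp_surjective_map[OF f, symmetric] by auto
qed

lemma top_manifold_homeomorphic:
  assumes f: "homeomorphic_map W W' f" and W: "top_manifold n W"
  shows "top_manifold n W'"
proof -
  have h: "W homeomorphic_space W'" using f homeomorphic_space by blast
  have "has_chart (half_space n) W' y" if y: "y \<in> topspace W'" for y
  proof -
    obtain x where "x \<in> topspace W" "y = f x"
      using y homeomorphic_imp_surjective_map[OF f] by blast
    then show ?thesis
      using has_chart_transfer[of W "topspace W" W' "topspace W'" f x "half_space n"] f W by (simp add: top_manifold_iff)
  qed
  then show ?thesis
    using W homeomorphic_Hausdorff_space[OF h] homeomorphic_space_second_countability[OF h]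
    unfolding top_manifold_iff by blast
qed

lemma cobordism_homeomorphic:
  assumes c: "cobordism n Y0 Y1 W h" and f: "homeomorphic_maps W W' f g"
  shows "cobordism n Y0 Y1 W' (f \<circ> h)"
proof -
  have fm: "homeomorphic_map W W' f" using f homeomorphic_maps_map by blast
  have "homeomorphic_map (subtopology W (manifold_boundary n W)) (subtopology W' (manifold_boundary n W')) f"
    unfolding homeomorphic_map_manifold_boundary[OF fm, symmetric]
    by (rule homeomorphic_map_restrict[OF fm]) (auto simp: manifold_boundary_def)
  then show ?thesis
    using c homeomorphic_map_compose[of "disjoint_sum_topology Y0 Y1" _ h _ f]
      top_manifold_homeomorphic[OF fm, of n] homotopy_equivalence_map_compose_homeomorphic[OF _ f]
      homeomorphic_compact_space[OF homeomorphic_maps_imp_homeomorphic_space[OF f]]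
    unfolding cobordism_def comp_assoc by metis
qed

text \<open>
  A point is encoded by the indicator sequence of the basic open sets that contain it.
\<close>

lemma homeomorphic_copy_on_sequences:
  assumes "Hausdorff_space X" "second_countable X"
  shows "\<exists>(W :: (nat \<Rightarrow> real) topology) f g. homeomorphic_maps X W f g"
proof -
  obtain \<B> where B: "countable \<B>" "\<And>U x. openin X U \<Longrightarrow> x \<in> U \<Longrightarrow> \<exists>V \<in> \<B>. x \<in> V \<and> V \<subseteq> U"
    using assms(2) unfolding second_countable_def by metis
  define f where "f = (\<lambda>x n. if x \<in> from_nat_into \<B> n then 1 else 0 :: real)"
  have inj: "inj_on f (topspace X)"
  proof (rule inj_onI, rule ccontr)
    fix x y assume xy: "x \<in> topspace X" "y \<in> topspace X" "f x = f y" "x \<noteq> y"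
    then obtain U where "openin X U" "x \<in> U" "y \<notin> U"
      using assms(1) unfolding Hausdorff_space_def disjnt_def by (metis IntI empty_iff)
    then obtain V where V: "V \<in> \<B>" "x \<in> V" "y \<notin> V" using B(2) by blast
    then have "f x (to_nat_on \<B> V) \<noteq> f y (to_nat_on \<B> V)" using B(1) by (simp add: f_def)
    then show False using xy(3) by simp
  qed
  define g where "g = inv_into (topspace X) f"
  have gf: "g (f x) = x" if "x \<in> topspace X" for x using inj that by (simp add: g_def)
  \<comment> \<open>The topology is carried over along \<open>g\<close> and not induced from the
    space of sequences, so the encoding \<open>f\<close> only has to be injective.\<close>
  define W where "W = pullback_topology (f ` topspace X) g X"
  have topW: "topspace W = f ` topspace X" using gf by (auto simp: W_def topspace_pullback_topology)
  have "continuous_map X X (g \<circ> f)"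
    by (rule continuous_map_eq[OF continuous_map_id]) (simp add: gf)
  then have "continuous_map X W f"
    unfolding W_def by (rule continuous_map_pullback') auto
  moreover have "continuous_map W X (id \<circ> g)"
    unfolding W_def by (rule continuous_map_pullback) (rule continuous_map_id)
  ultimately have "homeomorphic_maps X W f g"
    unfolding homeomorphic_maps_def using gf topW by auto
  then show ?thesis by blast
qed

theorem proposition2:
  fixes n :: nat and C0 :: "'a topology" and C1 :: "'b topology"
  assumes "n \<ge> 2"
    and "top_manifold n C0" and "compact_space C0" and "connected_space C0"
    and "connectedin C0 (manifold_boundary n C0)"
    and "top_manifold n C1" and "compact_space C1" and "connected_space C1"
    and "connectedin C1 (manifold_boundary n C1)"
    and "subtopology C0 (manifold_interior n C0) homeomorphic_space
         subtopology C1 (manifold_interior n C1)"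
  shows "top_h_cobordant (n - 1)
           (subtopology C0 (manifold_boundary n C0))
           (subtopology C1 (manifold_boundary n C1))"
proof -
  let ?Y0 = "subtopology C0 (manifold_boundary n C0)"
  let ?Y1 = "subtopology C1 (manifold_boundary n C1)"
  have n: "n \<ge> 1" "n - 1 + 1 = n" using assms(1) by auto
  obtain \<phi> \<psi> where "homeomorphic_maps (subtopology C0 (manifold_interior n C0))
      (subtopology C1 (manifold_interior n C1)) \<phi> \<psi>"
    using assms(10) unfolding homeomorphic_space_def by blast
  from cobordism_of_interiors[OF n(1) assms(2,3,6,7) this]
  obtain W h where c: "cobordism n ?Y0 ?Y1 (subtopology C1 W) h" by blast
  then have "Hausdorff_space (subtopology C1 W)" "second_countable (subtopology C1 W)"
    by (simp_all add: cobordism_def top_manifold_def)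
  \<comment> \<open>The cobordism consists of points of \<open>C1\<close>, whereas
    \<open>top_h_cobordant\<close> asks for points of type \<open>nat => real\<close>.\<close>
  from homeomorphic_copy_on_sequences[OF this]
  obtain W' :: "(nat \<Rightarrow> real) topology" and f g where "homeomorphic_maps (subtopology C1 W) W' f g"
    by blast
  from cobordism_homeomorphic[OF c this] have "cobordism n ?Y0 ?Y1 W' (f \<circ> h)" .
  then show ?thesis
    using closed_top_manifold_boundary[OF assms(1-3)] closed_top_manifold_boundary[OF assms(1,6,7)]
    unfolding top_h_cobordant_def cobordism_def n(2) by blast
qed

end
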